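(* Let $(\mathfrak g,\varphi_i,\xi_i,\eta_i,g)$ be an almost $3$-contact metric Lie algebra with a parallel canonical abelian structure such that $\delta\neq0$. Then $\mathfrak g=\mathfrak v\times\mathfrak h$, with $\mathfrak v\cong\mathfrak{so}(3)$ and $\mathfrak h$ carrying an abelian hypercomplex structure $J_i$, $i=1,2,3$. If $G$ is any Lie group with Lie algebra $\mathfrak g$, endowed with left invariant structure $(\varphi_i,\xi_i,\eta_i,g)$, the canonical connection of $G$ is the connection with skew torsion $$T=c-2\delta\,\eta_1\wedge\eta_2\wedge\eta_3,$$ where $c$ is the $3$-form defined on $\mathfrak h$ by $c(X,Y,Z)=-g([X,Y],Z)-g([Y,Z],X)-g([Z,X],Y)$.
   Context: An almost contact structure on a real Lie algebra $\mathfrak g$ is a triple $(\varphi,\xi,\eta)$, $\varphi\in\mathrm{End}(\mathfrak g)$, $\xi\in\mathfrak g$, $\eta\in\mathfrak g^*$, with $\varphi^2=-I+\eta\otimes\xi$ and $\eta(\xi)=1$. It is abelian if $\mathrm{ad}_\xi\circ\varphi=\varphi\circ\mathrm{ad}_\xi$ and $[\varphi X,\varphi Y]=[X,Y]$ for all $X,Y\in\operatorname{Ker}\eta$. An almost $3$-contact metric Lie algebra is a real Lie algebra $\mathfrak g$ of dimension $4n+3$ with three almost contact structures $(\varphi_i,\xi_i,\eta_i)$, $i=1,2,3$, such that for every even permutation $(i,j,k)$ of $(1,2,3)$: $\varphi_k=\varphi_i\varphi_j-\eta_j\otimes\xi_i=-\varphi_j\varphi_i+\eta_i\otimes\xi_j$,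 $\xi_k=\varphi_i\xi_j=-\varphi_j\xi_i$, $\eta_k=\eta_i\circ\varphi_j=-\eta_j\circ\varphi_i$, together with an inner product $g$ satisfying $g(\varphi_iX,\varphi_iY)=g(X,Y)-\eta_i(X)\eta_i(Y)$ for all $X,Y,i$. It is abelian if each $(\varphi_i,\xi_i,\eta_i)$ is abelian. Set $\mathfrak h=\bigcap_i\operatorname{Ker}\eta_i$, $\mathfrak v=\langle\xi_1,\xi_2,\xi_3\rangle$. For an abelian structure the following are well defined: $\mathcal Z:=\varphi_i([\xi_j,\xi_k])\in\mathfrak h$ and $\delta\in\mathbb R$ with $2\delta=\eta_i([\xi_j,\xi_k])$ (independent of the even permutation $(i,j,k)$ of $(1,2,3)$); and $\psi:=(\mathrm{ad}_{\xi_i}\circ\varphi_i)|_{\mathfrak h}=(\varphi_i\circ\mathrm{ad}_{\xi_i})|_{\mathfrak h}$ (independent of $i$). An abelian structure is parallel canonical if $\mathcal Z=0$ and $\psi=0$. In that case the canonical connection of $G$ is the unique metric connection $\nabla$ with totally skew-symmetric torsion (i.e. $T(X,Y,Z)=g(T(X,Y),Z)$ is a $3$-form) such that $\nabla\varphi_i=0$ for $i=1,2,3$ (it then also satisfies $\nabla\xi_i=0$, $\nabla\eta_i=0$). An abelian hypercomplex structure on a Lie algebra is a triple $J_1,J_2,J_3$ of endomorphisms with $J_i^2=-I$, $J_1J_2=-J_2J_1=J_3$ and $[J_iX,J_iY]=[X,Y]$ for all $X,Y,i$. Conventions: $(\eta_1\wedge\eta_2\wedge\eta_3)(\xi_1,\xi_2,\xi_3)=1$;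 $c$ is extended to $\mathfrak g$ by zero on $\mathfrak v$. *)

theory Defs
  imports "HOL-Analysis.Analysis" "HOL-Algebra.Group"
begin

section \<open>Real Lie algebras\<close>

text \<open>
  The class \<open>euclidean_space\<close> only provides a finite-dimensional real vector space
  (and its topology). Its inner product plays no role: the inner product of a metric structure
  is always a separate variable \<open>g\<close>.
\<close>

definition lie_algebra :: "('a::real_vector \<Rightarrow> 'a \<Rightarrow> 'a) \<Rightarrow> bool" where
  "lie_algebra br \<longleftrightarrow>
     (\<forall>x. linear (br x)) \<and> (\<forall>y. linear (\<lambda>x. br x y)) \<and>
     (\<forall>x. br x x = 0) \<and>
     (\<forall>x y z. br x (br y z) + br y (br z x) + br z (br x y) = 0)"

text \<open>Linearity of a map that is only relevant on a subspace \<open>V\<close>.\<close>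

definition linear_on_subspace ::
    "'a::real_vector set \<Rightarrow> ('a \<Rightarrow> 'b::real_vector) \<Rightarrow> bool" where
  "linear_on_subspace V f \<longleftrightarrow>
     (\<forall>x\<in>V. \<forall>y\<in>V. f (x + y) = f x + f y) \<and> (\<forall>r. \<forall>x\<in>V. f (r *\<^sub>R x) = r *\<^sub>R f x)"

text \<open>The subalgebras \<open>V\<close> and \<open>W\<close> are isomorphic Lie algebras.\<close>

definition lie_isomorphic ::
    "('a::real_vector \<Rightarrow> 'a \<Rightarrow> 'a) \<Rightarrow> 'a set \<Rightarrow>
     ('b::real_vector \<Rightarrow> 'b \<Rightarrow> 'b) \<Rightarrow> 'b set \<Rightarrow> bool" where
  "lie_isomorphic br V br' W \<longleftrightarrow>
     (\<exists>f. linear_on_subspace V f \<and> bij_betw f V W \<and>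
          (\<forall>x\<in>V. \<forall>y\<in>V. f (br x y) = br' (f x) (f y)))"

text \<open>The whole Lie algebra is the direct product of its subalgebras \<open>V\<close> and \<open>H\<close>.\<close>

definition lie_direct_product ::
    "('a::real_vector \<Rightarrow> 'a \<Rightarrow> 'a) \<Rightarrow> 'a set \<Rightarrow> 'a set \<Rightarrow> bool" where
  "lie_direct_product br V H \<longleftrightarrow>
     subspace V \<and> subspace H \<and> V \<inter> H = {0} \<and> (\<forall>z. \<exists>x\<in>V. \<exists>y\<in>H. z = x + y) \<and>
     (\<forall>x\<in>V. \<forall>y\<in>V. br x y \<in> V) \<and> (\<forall>x\<in>H. \<forall>y\<in>H. br x y \<in> H) \<and>
     (\<forall>x\<in>V. \<forall>y\<in>H. br x y = 0)"

definition so3 :: "(real^3^3) set" where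
  "so3 = {A. transpose A = - A}"

definition matrix_commutator :: "real^'n^'n \<Rightarrow> real^'n^'n \<Rightarrow> real^'n^'n" where
  "matrix_commutator A B = A ** B - B ** A"

text \<open>An abelian hypercomplex structure \<open>J 1, J 2, J 3\<close> on the subalgebra \<open>H\<close>.\<close>

definition abelian_hypercomplex ::
    "('a::real_vector \<Rightarrow> 'a \<Rightarrow> 'a) \<Rightarrow> 'a set \<Rightarrow> (nat \<Rightarrow> 'a \<Rightarrow> 'a) \<Rightarrow> bool" where
  "abelian_hypercomplex br H J \<longleftrightarrow>
     (\<forall>i\<in>{1,2,3}. linear_on_subspace H (J i) \<and> J i ` H \<subseteq> H \<and> (\<forall>x\<in>H. J i (J i x) = - x)) \<and>
     (\<forall>x\<in>H. J 1 (J 2 x) = J 3 x \<and> - J 2 (J 1 x) = J 3 x) \<and>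
     (\<forall>i\<in>{1,2,3}. \<forall>x\<in>H. \<forall>y\<in>H. br (J i x) (J i y) = br x y)"


section \<open>Almost 3-contact metric Lie algebras\<close>

definition almost_contact ::
    "('a::real_vector \<Rightarrow> 'a) \<Rightarrow> 'a \<Rightarrow> ('a \<Rightarrow> real) \<Rightarrow> bool" where
  "almost_contact \<phi> \<xi> \<eta> \<longleftrightarrow>
     linear \<phi> \<and> linear \<eta> \<and> (\<forall>X. \<phi> (\<phi> X) = - X + \<eta> X *\<^sub>R \<xi>) \<and> \<eta> \<xi> = 1"

definition abelian_almost_contact ::
    "('a::real_vector \<Rightarrow> 'a \<Rightarrow> 'a) \<Rightarrow> ('a \<Rightarrow> 'a) \<Rightarrow> 'a \<Rightarrow> ('a \<Rightarrow> real) \<Rightarrow> bool" where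
  "abelian_almost_contact br \<phi> \<xi> \<eta> \<longleftrightarrow>
     (\<forall>X. br \<xi> (\<phi> X) = \<phi> (br \<xi> X)) \<and>
     (\<forall>X Y. \<eta> X = 0 \<longrightarrow> \<eta> Y = 0 \<longrightarrow> br (\<phi> X) (\<phi> Y) = br X Y)"

text \<open>The even permutations of \<open>(1,2,3)\<close>.\<close>

definition even_perms3 :: "(nat \<times> nat \<times> nat) set" where
  "even_perms3 = {(1,2,3), (2,3,1), (3,1,2)}"

definition inner_product_on_space :: "('a::real_vector \<Rightarrow> 'a \<Rightarrow> real) \<Rightarrow> bool" where
  "inner_product_on_space g \<longleftrightarrow>
     (\<forall>x. linear (g x)) \<and> (\<forall>x y. g x y = g y x) \<and> (\<forall>x. x \<noteq> 0 \<longrightarrow> 0 < g x x)"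

text \<open>Only the indices 1, 2, 3 of the families \<open>\<phi>\<close>, \<open>\<xi>\<close>, \<open>\<eta>\<close> are relevant.\<close>

definition almost_3_contact_metric_lie_algebra ::
    "('a::euclidean_space \<Rightarrow> 'a \<Rightarrow> 'a) \<Rightarrow> (nat \<Rightarrow> 'a \<Rightarrow> 'a) \<Rightarrow> (nat \<Rightarrow> 'a) \<Rightarrow>
     (nat \<Rightarrow> 'a \<Rightarrow> real) \<Rightarrow> ('a \<Rightarrow> 'a \<Rightarrow> real) \<Rightarrow> bool" where
  "almost_3_contact_metric_lie_algebra br \<phi> \<xi> \<eta> g \<longleftrightarrow>
     lie_algebra br \<and> (\<exists>n. DIM('a) = 4 * n + 3) \<and>
     (\<forall>i\<in>{1,2,3}. almost_contact (\<phi> i) (\<xi> i) (\<eta> i)) \<and>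
     (\<forall>(i, j, k) \<in> even_perms3.
        (\<forall>X. \<phi> k X = \<phi> i (\<phi> j X) - \<eta> j X *\<^sub>R \<xi> i \<and>
             \<phi> k X = - \<phi> j (\<phi> i X) + \<eta> i X *\<^sub>R \<xi> j) \<and>
        \<xi> k = \<phi> i (\<xi> j) \<and> \<xi> k = - \<phi> j (\<xi> i) \<and>
        (\<forall>X. \<eta> k X = \<eta> i (\<phi> j X) \<and> \<eta> k X = - \<eta> j (\<phi> i X))) \<and>
     inner_product_on_space g \<and>
     (\<forall>i\<in>{1,2,3}. \<forall>X Y. g (\<phi> i X) (\<phi> i Y) = g X Y - \<eta> i X * \<eta> i Y)"

definition abelian_3_contact ::
    "('a::real_vector \<Rightarrow> 'a \<Rightarrow> 'a) \<Rightarrow> (nat \<Rightarrow> 'a \<Rightarrow> 'a) \<Rightarrow> (nat \<Rightarrow> 'a) \<Rightarrow>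
     (nat \<Rightarrow> 'a \<Rightarrow> real) \<Rightarrow> bool" where
  "abelian_3_contact br \<phi> \<xi> \<eta> \<longleftrightarrow>
     (\<forall>i\<in>{1,2,3}. abelian_almost_contact br (\<phi> i) (\<xi> i) (\<eta> i))"

definition horizontal :: "(nat \<Rightarrow> 'a \<Rightarrow> real) \<Rightarrow> 'a set" where
  "horizontal \<eta> = {X. \<forall>i\<in>{1,2,3}. \<eta> i X = 0}"

definition vertical :: "(nat \<Rightarrow> 'a::real_vector) \<Rightarrow> 'a set" where
  "vertical \<xi> = span {\<xi> 1, \<xi> 2, \<xi> 3}"

text \<open>
  The next three notions are defined through the representative \<open>(1,2,3)\<close>;
  that any other choice gives the same is shown in \<open>Z_vec_eq\<close>, \<open>Z_vec_horizontal\<close>,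
  \<open>delta_const_eq\<close>, \<open>psi_map_eq\<close>.
\<close>

definition Z_vec :: "('a \<Rightarrow> 'a \<Rightarrow> 'a) \<Rightarrow> (nat \<Rightarrow> 'a \<Rightarrow> 'a) \<Rightarrow> (nat \<Rightarrow> 'a) \<Rightarrow> 'a" where
  "Z_vec br \<phi> \<xi> = \<phi> 1 (br (\<xi> 2) (\<xi> 3))"

definition delta_const ::
    "('a \<Rightarrow> 'a \<Rightarrow> 'a) \<Rightarrow> (nat \<Rightarrow> 'a) \<Rightarrow> (nat \<Rightarrow> 'a \<Rightarrow> real) \<Rightarrow> real" where
  "delta_const br \<xi> \<eta> = \<eta> 1 (br (\<xi> 2) (\<xi> 3)) / 2"

definition psi_map :: "('a \<Rightarrow> 'a \<Rightarrow> 'a) \<Rightarrow> (nat \<Rightarrow> 'a \<Rightarrow> 'a) \<Rightarrow> (nat \<Rightarrow> 'a) \<Rightarrow> 'a \<Rightarrow> 'a" where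
  "psi_map br \<phi> \<xi> X = br (\<xi> 1) (\<phi> 1 X)"

definition parallel_canonical ::
    "('a::real_vector \<Rightarrow> 'a \<Rightarrow> 'a) \<Rightarrow> (nat \<Rightarrow> 'a \<Rightarrow> 'a) \<Rightarrow> (nat \<Rightarrow> 'a) \<Rightarrow>
     (nat \<Rightarrow> 'a \<Rightarrow> real) \<Rightarrow> bool" where
  "parallel_canonical br \<phi> \<xi> \<eta> \<longleftrightarrow>
     abelian_3_contact br \<phi> \<xi> \<eta> \<and>
     Z_vec br \<phi> \<xi> = 0 \<and> (\<forall>X\<in>horizontal \<eta>. psi_map br \<phi> \<xi> X = 0)"

context
  fixes br :: "'a::euclidean_space \<Rightarrow> 'a \<Rightarrow> 'a" and \<phi> \<xi> \<eta> g
  assumes str: "almost_3_contact_metric_lie_algebra br \<phi> \<xi> \<eta> g"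
    and ab: "abelian_3_contact br \<phi> \<xi> \<eta>"
begin

private lemma br: "linear (br x)" "linear (\<lambda>x. br x y)" "br x x = 0"
  using str unfolding almost_3_contact_metric_lie_algebra_def lie_algebra_def by blast+

private lemma br_minus: "br x (- y) = - br x y" "br (- x) y = - br x y"
  using linear_neg[OF br(1)] linear_neg[OF br(2)] by auto

private lemma br_swap: "br x y = - br y x"
proof -
  have "br (x + y) (x + y) = br x x + br x y + (br y x + br y y)"
    using linear_add[OF br(1)] linear_add[OF br(2)] by (metis add.assoc add.left_commute)
  then show ?thesis using br(3) by (metis add.left_neutral add.right_neutral eq_neg_iff_add_eq_0)
qed

private lemma contact:
  "\<phi> 1 (\<phi> 1 X) = - X + \<eta> 1 X *\<^sub>R \<xi> 1" "\<phi> 2 (\<phi> 2 X) = - X + \<eta> 2 X *\<^sub>R \<xi> 2"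
  "\<phi> 3 (\<phi> 3 X) = - X + \<eta> 3 X *\<^sub>R \<xi> 3" "\<eta> 1 (\<xi> 1) = 1" "\<eta> 2 (\<xi> 2) = 1" "\<eta> 3 (\<xi> 3) = 1"
  "linear (\<phi> 1)" "linear (\<phi> 2)" "linear (\<phi> 3)" "linear (\<eta> 1)" "linear (\<eta> 2)" "linear (\<eta> 3)"
proof -
  have "\<forall>i\<in>{1,2,3}. almost_contact (\<phi> i) (\<xi> i) (\<eta> i)"
    using str unfolding almost_3_contact_metric_lie_algebra_def by blast
  then show
    "\<phi> 1 (\<phi> 1 X) = - X + \<eta> 1 X *\<^sub>R \<xi> 1" "\<phi> 2 (\<phi> 2 X) = - X + \<eta> 2 X *\<^sub>R \<xi> 2"
    "\<phi> 3 (\<phi> 3 X) = - X + \<eta> 3 X *\<^sub>R \<xi> 3" "\<eta> 1 (\<xi> 1) = 1" "\<eta> 2 (\<xi> 2) = 1" "\<eta> 3 (\<xi> 3) = 1"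
    "linear (\<phi> 1)" "linear (\<phi> 2)" "linear (\<phi> 3)" "linear (\<eta> 1)" "linear (\<eta> 2)" "linear (\<eta> 3)"
    by (simp_all add: almost_contact_def)
qed

private lemma three:
  "\<phi> 3 X = \<phi> 1 (\<phi> 2 X) - \<eta> 2 X *\<^sub>R \<xi> 1" "\<phi> 1 X = \<phi> 2 (\<phi> 3 X) - \<eta> 3 X *\<^sub>R \<xi> 2"
  "\<phi> 2 X = \<phi> 3 (\<phi> 1 X) - \<eta> 1 X *\<^sub>R \<xi> 3"
  "\<xi> 3 = \<phi> 1 (\<xi> 2)" "\<xi> 1 = \<phi> 2 (\<xi> 3)" "\<xi> 2 = \<phi> 3 (\<xi> 1)"
  "\<xi> 3 = - \<phi> 2 (\<xi> 1)" "\<xi> 1 = - \<phi> 3 (\<xi> 2)" "\<xi> 2 = - \<phi> 1 (\<xi> 3)"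
  "\<eta> 3 X = \<eta> 1 (\<phi> 2 X)" "\<eta> 1 X = \<eta> 2 (\<phi> 3 X)" "\<eta> 2 X = \<eta> 3 (\<phi> 1 X)"
  "\<eta> 3 X = - \<eta> 2 (\<phi> 1 X)" "\<eta> 1 X = - \<eta> 3 (\<phi> 2 X)" "\<eta> 2 X = - \<eta> 1 (\<phi> 3 X)"
proof -
  have *: "(\<forall>X. \<phi> k X = \<phi> i (\<phi> j X) - \<eta> j X *\<^sub>R \<xi> i \<and>
      \<phi> k X = - \<phi> j (\<phi> i X) + \<eta> i X *\<^sub>R \<xi> j) \<and>
    \<xi> k = \<phi> i (\<xi> j) \<and> \<xi> k = - \<phi> j (\<xi> i) \<and>
    (\<forall>X. \<eta> k X = \<eta> i (\<phi> j X) \<and> \<eta> k X = - \<eta> j (\<phi> i X))"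
    if "(i, j, k) \<in> even_perms3" for i j k
    using str that unfolding almost_3_contact_metric_lie_algebra_def by fast
  have m: "(1, 2, 3) \<in> even_perms3" "(2, 3, 1) \<in> even_perms3" "(3, 1, 2) \<in> even_perms3"
    by (simp_all add: even_perms3_def)
  show
  "\<phi> 3 X = \<phi> 1 (\<phi> 2 X) - \<eta> 2 X *\<^sub>R \<xi> 1" "\<phi> 1 X = \<phi> 2 (\<phi> 3 X) - \<eta> 3 X *\<^sub>R \<xi> 2"
  "\<phi> 2 X = \<phi> 3 (\<phi> 1 X) - \<eta> 1 X *\<^sub>R \<xi> 3"
  "\<xi> 3 = \<phi> 1 (\<xi> 2)" "\<xi> 1 = \<phi> 2 (\<xi> 3)" "\<xi> 2 = \<phi> 3 (\<xi> 1)"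
  "\<xi> 3 = - \<phi> 2 (\<xi> 1)" "\<xi> 1 = - \<phi> 3 (\<xi> 2)" "\<xi> 2 = - \<phi> 1 (\<xi> 3)"
  "\<eta> 3 X = \<eta> 1 (\<phi> 2 X)" "\<eta> 1 X = \<eta> 2 (\<phi> 3 X)" "\<eta> 2 X = \<eta> 3 (\<phi> 1 X)"
  "\<eta> 3 X = - \<eta> 2 (\<phi> 1 X)" "\<eta> 1 X = - \<eta> 3 (\<phi> 2 X)" "\<eta> 2 X = - \<eta> 1 (\<phi> 3 X)"
    using *[OF m(1)] *[OF m(2)] *[OF m(3)] by metis+
qed

private lemma abel:
  "br (\<xi> 1) (\<phi> 1 X) = \<phi> 1 (br (\<xi> 1) X)" "br (\<xi> 2) (\<phi> 2 X) = \<phi> 2 (br (\<xi> 2) X)"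
  "br (\<xi> 3) (\<phi> 3 X) = \<phi> 3 (br (\<xi> 3) X)"
  "\<eta> 1 X = 0 \<Longrightarrow> \<eta> 1 Y = 0 \<Longrightarrow> br (\<phi> 1 X) (\<phi> 1 Y) = br X Y"
  "\<eta> 2 X = 0 \<Longrightarrow> \<eta> 2 Y = 0 \<Longrightarrow> br (\<phi> 2 X) (\<phi> 2 Y) = br X Y"
  "\<eta> 3 X = 0 \<Longrightarrow> \<eta> 3 Y = 0 \<Longrightarrow> br (\<phi> 3 X) (\<phi> 3 Y) = br X Y"
  using ab unfolding abelian_3_contact_def abelian_almost_contact_def by auto

private lemma phi_xi: "\<phi> i (\<xi> i) = 0" "\<eta> i (\<phi> i X) = 0" if "i \<in> {1,2,3}"
proof -
  have *: "f x = 0" "h (f y) = 0"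
    if f: "linear f" "linear h" "\<And>X. f (f X) = - X + h X *\<^sub>R x" "h x = 1" for f h and x y :: 'a
  proof -
    have "x \<noteq> 0" using f(2,4) linear_0 by fastforce
    have a: "h (f y) *\<^sub>R x = h y *\<^sub>R f x" for y
    proof -
      have "- f y + h (f y) *\<^sub>R x = f (f (f y))" by (rule f(3)[symmetric])
      also have "\<dots> = f (- y + h y *\<^sub>R x)" by (rule arg_cong[OF f(3)])
      also have "\<dots> = - f y + h y *\<^sub>R f x"
        by (simp only: linear_add[OF f(1)] linear_neg[OF f(1)] linear_scale[OF f(1)])
      finally show ?thesis by simp
    qed
    have b: "h (f x) *\<^sub>R x = f x" using a[of x] f(4) by simp
    have "f (f x) = 0" using f(3)[of x] f(4) by simp
    then have "h (f x) *\<^sub>R f x = 0" using b f(1) by (metis linear_scale)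
    then show "f x = 0" using b by force
    then show "h (f y) = 0" using a[of y] \<open>x \<noteq> 0\<close> by simp
  qed
  show "\<phi> i (\<xi> i) = 0" "\<eta> i (\<phi> i X) = 0"
    using that *[OF contact(7,10,1,4)] *[OF contact(8,11,2,5)] *[OF contact(9,12,3,6)] by auto
qed

private lemma brackets:
  "\<phi> 2 (br (\<xi> 2) (\<xi> 3)) = - br (\<xi> 1) (\<xi> 2)" "\<phi> 3 (br (\<xi> 2) (\<xi> 3)) = br (\<xi> 3) (\<xi> 1)"
  "\<phi> 1 (br (\<xi> 3) (\<xi> 1)) = br (\<xi> 1) (\<xi> 2)" "\<phi> 3 (br (\<xi> 3) (\<xi> 1)) = - br (\<xi> 2) (\<xi> 3)"
  "\<phi> 1 (br (\<xi> 1) (\<xi> 2)) = - br (\<xi> 3) (\<xi> 1)" "\<phi> 2 (br (\<xi> 1) (\<xi> 2)) = br (\<xi> 2) (\<xi> 3)"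
proof -
  have xi: "\<phi> 1 (\<xi> 2) = \<xi> 3" "\<phi> 2 (\<xi> 3) = \<xi> 1" "\<phi> 3 (\<xi> 1) = \<xi> 2"
    "\<phi> 2 (\<xi> 1) = - \<xi> 3" "\<phi> 3 (\<xi> 2) = - \<xi> 1" "\<phi> 1 (\<xi> 3) = - \<xi> 2"
    using three(4-9) by (metis minus_minus)+
  show "\<phi> 2 (br (\<xi> 2) (\<xi> 3)) = - br (\<xi> 1) (\<xi> 2)"
    using abel(2)[of "\<xi> 3"] br_swap[of "\<xi> 1"] by (simp add: xi br_minus del: One_nat_def)
  show "\<phi> 3 (br (\<xi> 2) (\<xi> 3)) = br (\<xi> 3) (\<xi> 1)"
    using abel(3)[of "\<xi> 2"] br_swap[of "\<xi> 3" "\<xi> 2"] linear_neg[OF contact(9)]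
    by (simp add: xi br_minus del: One_nat_def)
  show "\<phi> 1 (br (\<xi> 3) (\<xi> 1)) = br (\<xi> 1) (\<xi> 2)"
    using abel(1)[of "\<xi> 3"] br_swap[of "\<xi> 1" "\<xi> 3"] linear_neg[OF contact(7)]
    by (simp add: xi br_minus del: One_nat_def)
  show "\<phi> 3 (br (\<xi> 3) (\<xi> 1)) = - br (\<xi> 2) (\<xi> 3)"
    using abel(3)[of "\<xi> 1"] br_swap[of "\<xi> 2"] by (simp add: xi br_minus del: One_nat_def)
  show "\<phi> 1 (br (\<xi> 1) (\<xi> 2)) = - br (\<xi> 3) (\<xi> 1)"
    using abel(1)[of "\<xi> 2"] br_swap[of "\<xi> 3"] by (simp add: xi br_minus del: One_nat_def)
  show "\<phi> 2 (br (\<xi> 1) (\<xi> 2)) = br (\<xi> 2) (\<xi> 3)"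
    using abel(2)[of "\<xi> 1"] br_swap[of "\<xi> 2" "\<xi> 1"] linear_neg[OF contact(8)]
    by (simp add: xi br_minus del: One_nat_def)
qed

private lemma eta_brackets:
  "\<eta> 2 (br (\<xi> 2) (\<xi> 3)) = 0" "\<eta> 3 (br (\<xi> 2) (\<xi> 3)) = 0"
  "\<eta> 1 (br (\<xi> 3) (\<xi> 1)) = 0" "\<eta> 3 (br (\<xi> 3) (\<xi> 1)) = 0"
  "\<eta> 1 (br (\<xi> 1) (\<xi> 2)) = 0" "\<eta> 2 (br (\<xi> 1) (\<xi> 2)) = 0"
  "\<eta> 2 (br (\<xi> 3) (\<xi> 1)) = \<eta> 1 (br (\<xi> 2) (\<xi> 3))"
  "\<eta> 3 (br (\<xi> 1) (\<xi> 2)) = \<eta> 1 (br (\<xi> 2) (\<xi> 3))"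
proof -
  have e: "\<eta> 1 (\<phi> 1 X) = 0" "\<eta> 2 (\<phi> 2 X) = 0" "\<eta> 3 (\<phi> 3 X) = 0" for X
    by (rule phi_xi(2), simp)+
  note n = linear_neg[OF contact(10)] linear_neg[OF contact(11)] linear_neg[OF contact(12)]
  show "\<eta> 2 (br (\<xi> 2) (\<xi> 3)) = 0"
    using e(2)[of "br (\<xi> 1) (\<xi> 2)"] by (simp only: brackets n neg_equal_0_iff_equal)
  show "\<eta> 3 (br (\<xi> 2) (\<xi> 3)) = 0"
    using e(3)[of "br (\<xi> 3) (\<xi> 1)"] by (simp only: brackets n neg_equal_0_iff_equal)
  show "\<eta> 1 (br (\<xi> 3) (\<xi> 1)) = 0"
    using e(1)[of "br (\<xi> 1) (\<xi> 2)"] by (simp only: brackets n neg_equal_0_iff_equal)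
  show "\<eta> 3 (br (\<xi> 3) (\<xi> 1)) = 0"
    using e(3)[of "br (\<xi> 2) (\<xi> 3)"] by (simp only: brackets n neg_equal_0_iff_equal)
  show "\<eta> 1 (br (\<xi> 1) (\<xi> 2)) = 0"
    using e(1)[of "br (\<xi> 3) (\<xi> 1)"] by (simp only: brackets n neg_equal_0_iff_equal)
  show "\<eta> 2 (br (\<xi> 1) (\<xi> 2)) = 0"
    using e(2)[of "br (\<xi> 2) (\<xi> 3)"] by (simp only: brackets n neg_equal_0_iff_equal)
  show "\<eta> 2 (br (\<xi> 3) (\<xi> 1)) = \<eta> 1 (br (\<xi> 2) (\<xi> 3))"
    using three(11)[of "br (\<xi> 2) (\<xi> 3)"] by (simp only: brackets)
  show "\<eta> 3 (br (\<xi> 1) (\<xi> 2)) = \<eta> 1 (br (\<xi> 2) (\<xi> 3))"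
    using three(10)[of "br (\<xi> 1) (\<xi> 2)"] by (simp only: brackets)
qed

lemma delta_const_eq:
  assumes "(i, j, k) \<in> even_perms3"
  shows "2 * delta_const br \<xi> \<eta> = \<eta> i (br (\<xi> j) (\<xi> k))"
  using assms eta_brackets by (auto simp: delta_const_def even_perms3_def)

lemma Z_vec_eq:
  assumes "(i, j, k) \<in> even_perms3"
  shows "Z_vec br \<phi> \<xi> = \<phi> i (br (\<xi> j) (\<xi> k))"
proof -
  have "\<phi> 1 (br (\<xi> 2) (\<xi> 3)) = \<phi> 3 (br (\<xi> 1) (\<xi> 2))"
    using three(1)[of "br (\<xi> 1) (\<xi> 2)"] brackets(6) eta_brackets(6) by simp
  moreover have "\<phi> 2 (br (\<xi> 3) (\<xi> 1)) = \<phi> 1 (br (\<xi> 2) (\<xi> 3))"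
    using three(2)[of "br (\<xi> 2) (\<xi> 3)"] brackets(2) eta_brackets(2) by simp
  ultimately show ?thesis using assms by (auto simp: Z_vec_def even_perms3_def)
qed

lemma Z_vec_horizontal: "Z_vec br \<phi> \<xi> \<in> horizontal \<eta>"
proof -
  have "\<eta> i (Z_vec br \<phi> \<xi>) = 0" if "(i, j, k) \<in> even_perms3" for i j k
  proof -
    have "i \<in> {1,2,3}" using that by (auto simp: even_perms3_def)
    then show ?thesis using phi_xi(2) by (simp only: Z_vec_eq[OF that])
  qed
  then show ?thesis by (auto simp: horizontal_def even_perms3_def)
qed

lemma psi_map_eq:
  assumes "i \<in> {1,2,3}" and "X \<in> horizontal \<eta>"
  shows "psi_map br \<phi> \<xi> X = br (\<xi> i) (\<phi> i X)" "psi_map br \<phi> \<xi> X = \<phi> i (br (\<xi> i) X)"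
proof -
  have X: "\<eta> 1 X = 0" "\<eta> 2 X = 0" "\<eta> 3 X = 0" using assms(2) by (auto simp: horizontal_def)
  have x3: "\<eta> 2 (\<xi> 3) = 0"
    using three(7) phi_xi(2)[of 2 "\<xi> 1"] linear_neg[OF contact(11)] by simp
  have x1: "\<eta> 3 (\<xi> 1) = 0"
    using three(8) phi_xi(2)[of 3 "\<xi> 2"] linear_neg[OF contact(12)] by simp
  have y: "\<eta> 2 (\<phi> 3 X) = 0" "\<eta> 3 (\<phi> 1 X) = 0" using X three(11)[of X] three(12)[of X] by auto
  have 1: "br (\<xi> 1) (\<phi> 1 X) = br (\<xi> 3) (\<phi> 3 X)"
    using abel(5)[OF x3 y(1)] three(5) three(2)[of X] X by simp
  have 2: "br (\<xi> 2) (\<phi> 2 X) = br (\<xi> 1) (\<phi> 1 X)"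
    using abel(6)[OF x1 y(2)] three(6) three(3)[of X] X by simp
  show r: "psi_map br \<phi> \<xi> X = br (\<xi> i) (\<phi> i X)"
    using assms(1) 1 2 by (auto simp: psi_map_def)
  then show "psi_map br \<phi> \<xi> X = \<phi> i (br (\<xi> i) X)"
    using assms(1) abel(1-3) by auto
qed

end


section \<open>The 3-form \<open>T\<close>\<close>

definition wedge3 ::
    "('a \<Rightarrow> real) \<Rightarrow> ('a \<Rightarrow> real) \<Rightarrow> ('a \<Rightarrow> real) \<Rightarrow> 'a \<Rightarrow> 'a \<Rightarrow> 'a \<Rightarrow> real" where
  "wedge3 \<alpha> \<beta> \<gamma> X Y Z =
     \<alpha> X * \<beta> Y * \<gamma> Z + \<alpha> Y * \<beta> Z * \<gamma> X + \<alpha> Z * \<beta> X * \<gamma> Y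
     - \<alpha> X * \<beta> Z * \<gamma> Y - \<alpha> Y * \<beta> X * \<gamma> Z - \<alpha> Z * \<beta> Y * \<gamma> X"

definition c_form_h ::
    "('a \<Rightarrow> 'a \<Rightarrow> 'a) \<Rightarrow> ('a \<Rightarrow> 'a \<Rightarrow> real) \<Rightarrow> 'a \<Rightarrow> 'a \<Rightarrow> 'a \<Rightarrow> real" where
  "c_form_h br g X Y Z = - g (br X Y) Z - g (br Y Z) X - g (br Z X) Y"

text \<open>The projection onto the horizontal space along the vertical space.\<close>

definition hor_part ::
    "(nat \<Rightarrow> 'a::real_vector) \<Rightarrow> (nat \<Rightarrow> 'a \<Rightarrow> real) \<Rightarrow> 'a \<Rightarrow> 'a" where
  "hor_part \<xi> \<eta> X = X - (\<Sum>i\<in>{1,2,3}. \<eta> i X *\<^sub>R \<xi> i)"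

text \<open>Extending \<open>c_form_h\<close> by zero on the vertical space means composing with \<open>hor_part\<close>.\<close>

definition c_form ::
    "('a::real_vector \<Rightarrow> 'a \<Rightarrow> 'a) \<Rightarrow> (nat \<Rightarrow> 'a) \<Rightarrow> (nat \<Rightarrow> 'a \<Rightarrow> real) \<Rightarrow>
     ('a \<Rightarrow> 'a \<Rightarrow> real) \<Rightarrow> 'a \<Rightarrow> 'a \<Rightarrow> 'a \<Rightarrow> real" where
  "c_form br \<xi> \<eta> g X Y Z =
     c_form_h br g (hor_part \<xi> \<eta> X) (hor_part \<xi> \<eta> Y) (hor_part \<xi> \<eta> Z)"

definition T_form ::
    "('a::real_vector \<Rightarrow> 'a \<Rightarrow> 'a) \<Rightarrow> (nat \<Rightarrow> 'a) \<Rightarrow> (nat \<Rightarrow> 'a \<Rightarrow> real) \<Rightarrow>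
     ('a \<Rightarrow> 'a \<Rightarrow> real) \<Rightarrow> 'a \<Rightarrow> 'a \<Rightarrow> 'a \<Rightarrow> real" where
  "T_form br \<xi> \<eta> g X Y Z =
     c_form br \<xi> \<eta> g X Y Z - 2 * delta_const br \<xi> \<eta> * wedge3 (\<eta> 1) (\<eta> 2) (\<eta> 3) X Y Z"


section \<open>Smooth manifolds and Lie groups\<close>

text \<open>On an open set \<open>S\<close>, \<open>Ck_on k S f\<close> says that \<open>f\<close> is \<open>k\<close> times continuously differentiable.\<close>

primrec Ck_on ::
    "nat \<Rightarrow> 'a::euclidean_space set \<Rightarrow> ('a \<Rightarrow> 'b::real_normed_vector) \<Rightarrow> bool" where
  "Ck_on 0 S f \<longleftrightarrow> continuous_on S f"
| "Ck_on (Suc k) S f \<longleftrightarrow>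
     (\<forall>x\<in>S. f differentiable (at x)) \<and> (\<forall>v. Ck_on k S (\<lambda>x. frechet_derivative f (at x) v))"

definition smooth_on ::
    "'a::euclidean_space set \<Rightarrow> ('a \<Rightarrow> 'b::real_normed_vector) \<Rightarrow> bool" where
  "smooth_on S f \<longleftrightarrow> (\<forall>k. Ck_on k S f)"

text \<open>
  A smooth structure is given by a (not necessarily maximal) atlas of charts \<open>(U, c)\<close>, with
  \<open>c\<close> a homeomorphism of the open set \<open>U\<close> onto an open subset of the model space \<open>'e\<close>.
  The inverse chart is \<open>inv_into U c\<close>. A Lie group with Lie algebra \<open>'a\<close> has the dimension
  of \<open>'a\<close>, so it may be modelled on \<open>'e = 'a\<close> without loss of generality.
\<close>

type_synonym ('p, 'e) atlas = "('p set \<times> ('p \<Rightarrow> 'e)) set"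

definition smooth_atlas ::
    "('p::topological_space, 'e::euclidean_space) atlas \<Rightarrow> bool" where
  "smooth_atlas A \<longleftrightarrow>
     (\<forall>(U, c)\<in>A. open U \<and> open (c ` U) \<and> homeomorphism U (c ` U) c (inv_into U c)) \<and>
     (\<Union>(U, c)\<in>A. U) = UNIV \<and>
     (\<forall>(U, c)\<in>A. \<forall>(V, d)\<in>A. smooth_on (c ` (U \<inter> V)) (d \<circ> inv_into U c))"

definition product_atlas ::
    "('p, 'e) atlas \<Rightarrow> ('q, 'f) atlas \<Rightarrow> ('p \<times> 'q, 'e \<times> 'f) atlas" where
  "product_atlas A B = {(U \<times> V, map_prod c d) |U c V d. (U, c) \<in> A \<and> (V, d) \<in> B}"

definition smooth_map ::
    "('p::topological_space, 'e::euclidean_space) atlas \<Rightarrow>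
     ('q::topological_space, 'f::euclidean_space) atlas \<Rightarrow> ('p \<Rightarrow> 'q) \<Rightarrow> bool" where
  "smooth_map A B F \<longleftrightarrow>
     continuous_on UNIV F \<and>
     (\<forall>(U, c)\<in>A. \<forall>(V, d)\<in>B. smooth_on (c ` (U \<inter> F -` V)) (d \<circ> F \<circ> inv_into U c))"

definition lie_group ::
    "'p::{t2_space, second_countable_topology} monoid \<Rightarrow> ('p, 'e::euclidean_space) atlas \<Rightarrow> bool"
  where
  "lie_group G A \<longleftrightarrow>
     group G \<and> carrier G = UNIV \<and> smooth_atlas A \<and>
     smooth_map (product_atlas A A) A (\<lambda>(x, y). x \<otimes>\<^bsub>G\<^esub> y) \<and>
     smooth_map A A (\<lambda>x. inv\<^bsub>G\<^esub> x)"

text \<open>Real functions that are smooth on the open set \<open>W\<close>, or on some neighbourhood of \<open>p\<close>.\<close>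

definition smooth_fun_on ::
    "('p::topological_space, 'e::euclidean_space) atlas \<Rightarrow> 'p set \<Rightarrow> ('p \<Rightarrow> real) \<Rightarrow> bool" where
  "smooth_fun_on A W f \<longleftrightarrow> (\<forall>(U, c)\<in>A. smooth_on (c ` (U \<inter> W)) (f \<circ> inv_into U c))"

definition smooth_near ::
    "('p::topological_space, 'e::euclidean_space) atlas \<Rightarrow> 'p \<Rightarrow> ('p \<Rightarrow> real) \<Rightarrow> bool" where
  "smooth_near A p f \<longleftrightarrow> (\<exists>W. open W \<and> p \<in> W \<and> smooth_fun_on A W f)"

text \<open>
  A tangent vector at \<open>p\<close> is the directional derivative, in some direction \<open>v\<close> of some chart
  around \<open>p\<close>, acting on the functions that are smooth near \<open>p\<close>. Tangent vectors send all
  other functions to 0, so that equality of tangent vectors is equality of HOL functions.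
\<close>

type_synonym 'p vfield = "'p \<Rightarrow> ('p \<Rightarrow> real) \<Rightarrow> real"

definition tangent_space ::
    "('p::topological_space, 'e::euclidean_space) atlas \<Rightarrow> 'p \<Rightarrow> (('p \<Rightarrow> real) \<Rightarrow> real) set" where
  "tangent_space A p =
     {\<lambda>f. if smooth_near A p f then frechet_derivative (f \<circ> inv_into U c) (at (c p)) v else 0
      |U c v. (U, c) \<in> A \<and> p \<in> U}"

definition vector_fields ::
    "('p::topological_space, 'e::euclidean_space) atlas \<Rightarrow> 'p vfield set" where
  "vector_fields A =
     {X. (\<forall>p. X p \<in> tangent_space A p) \<and>
         (\<forall>W f. open W \<longrightarrow> smooth_fun_on A W f \<longrightarrow> smooth_fun_on A W (\<lambda>p. X p f))}"

definition vf_add :: "'p vfield \<Rightarrow> 'p vfield \<Rightarrow> 'p vfield" where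
  "vf_add X Y = (\<lambda>p f. X p f + Y p f)"

definition vf_scale :: "('p \<Rightarrow> real) \<Rightarrow> 'p vfield \<Rightarrow> 'p vfield" where
  "vf_scale h X = (\<lambda>p f. h p * X p f)"

definition vf_diff :: "'p vfield \<Rightarrow> 'p vfield \<Rightarrow> 'p vfield" where
  "vf_diff X Y = (\<lambda>p f. X p f - Y p f)"

definition vf_bracket ::
    "('p::topological_space, 'e::euclidean_space) atlas \<Rightarrow> 'p vfield \<Rightarrow> 'p vfield \<Rightarrow> 'p vfield"
  where
  "vf_bracket A X Y =
     (\<lambda>p f. if smooth_near A p f then X p (\<lambda>q. Y q f) - Y p (\<lambda>q. X q f) else 0)"

definition left_invariant_fields ::
    "'p::topological_space monoid \<Rightarrow> ('p, 'e::euclidean_space) atlas \<Rightarrow> 'p vfield set" where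
  "left_invariant_fields G A =
     {X \<in> vector_fields A. \<forall>a p f. X (a \<otimes>\<^bsub>G\<^esub> p) f = X p (\<lambda>q. f (a \<otimes>\<^bsub>G\<^esub> q))}"

text \<open>
  \<open>L\<close> identifies the Lie algebra with the Lie algebra of left invariant vector fields on \<open>G\<close>.
\<close>

definition lie_algebra_of_group ::
    "'p::topological_space monoid \<Rightarrow> ('p, 'e::euclidean_space) atlas \<Rightarrow>
     ('a::real_vector \<Rightarrow> 'a \<Rightarrow> 'a) \<Rightarrow> ('a \<Rightarrow> 'p vfield) \<Rightarrow> bool" where
  "lie_algebra_of_group G A br L \<longleftrightarrow>
     bij_betw L UNIV (left_invariant_fields G A) \<and>
     (\<forall>x y. L (x + y) = vf_add (L x) (L y)) \<and>
     (\<forall>r x. L (r *\<^sub>R x) = vf_scale (\<lambda>_. r) (L x)) \<and>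
     (\<forall>x y. L (br x y) = vf_bracket A (L x) (L y))"

text \<open>
  \<open>maurer_cartan L X p\<close> is the element of the Lie algebra whose left invariant field agrees at
  \<open>p\<close> with \<open>X\<close>. The left invariant extension to \<open>G\<close> of a tensor on the Lie algebra is obtained
  by applying the tensor to these elements.
\<close>

definition maurer_cartan :: "('a \<Rightarrow> 'p vfield) \<Rightarrow> 'p vfield \<Rightarrow> 'p \<Rightarrow> 'a" where
  "maurer_cartan L X p = inv_into UNIV (\<lambda>x. L x p) (X p)"

definition li_endo :: "('a \<Rightarrow> 'p vfield) \<Rightarrow> ('a \<Rightarrow> 'a) \<Rightarrow> 'p vfield \<Rightarrow> 'p vfield" where
  "li_endo L \<phi> X = (\<lambda>p. L (\<phi> (maurer_cartan L X p)) p)"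

definition li_form2 ::
    "('a \<Rightarrow> 'p vfield) \<Rightarrow> ('a \<Rightarrow> 'a \<Rightarrow> real) \<Rightarrow> 'p vfield \<Rightarrow> 'p vfield \<Rightarrow> 'p \<Rightarrow> real" where
  "li_form2 L g X Y p = g (maurer_cartan L X p) (maurer_cartan L Y p)"

definition li_form3 ::
    "('a \<Rightarrow> 'p vfield) \<Rightarrow> ('a \<Rightarrow> 'a \<Rightarrow> 'a \<Rightarrow> real) \<Rightarrow>
     'p vfield \<Rightarrow> 'p vfield \<Rightarrow> 'p vfield \<Rightarrow> 'p \<Rightarrow> real" where
  "li_form3 L T X Y Z p = T (maurer_cartan L X p) (maurer_cartan L Y p) (maurer_cartan L Z p)"


section \<open>Connections\<close>

text \<open>
  \<open>D X Y\<close> is the covariant derivative of \<open>Y\<close> along \<open>X\<close>. Outside smooth vector fields the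
  value is fixed to \<open>undefined\<close>, so that equality of connections is equality of HOL functions.
\<close>

definition affine_connection ::
    "('p::topological_space, 'e::euclidean_space) atlas \<Rightarrow>
     ('p vfield \<Rightarrow> 'p vfield \<Rightarrow> 'p vfield) \<Rightarrow> bool" where
  "affine_connection A D \<longleftrightarrow>
     (\<forall>X Y. \<not> (X \<in> vector_fields A \<and> Y \<in> vector_fields A) \<longrightarrow> D X Y = undefined) \<and>
     (\<forall>X\<in>vector_fields A. \<forall>Y\<in>vector_fields A. D X Y \<in> vector_fields A) \<and>
     (\<forall>X\<in>vector_fields A. \<forall>X'\<in>vector_fields A. \<forall>Y\<in>vector_fields A.
        D (vf_add X X') Y = vf_add (D X Y) (D X' Y)) \<and>
     (\<forall>X\<in>vector_fields A. \<forall>Y\<in>vector_fields A. \<forall>Y'\<in>vector_fields A.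
        D X (vf_add Y Y') = vf_add (D X Y) (D X Y')) \<and>
     (\<forall>h. smooth_fun_on A UNIV h \<longrightarrow>
        (\<forall>X\<in>vector_fields A. \<forall>Y\<in>vector_fields A.
           D (vf_scale h X) Y = vf_scale h (D X Y) \<and>
           D X (vf_scale h Y) = vf_add (vf_scale (\<lambda>p. X p h) Y) (vf_scale h (D X Y))))"

definition torsion ::
    "('p::topological_space, 'e::euclidean_space) atlas \<Rightarrow>
     ('p vfield \<Rightarrow> 'p vfield \<Rightarrow> 'p vfield) \<Rightarrow> 'p vfield \<Rightarrow> 'p vfield \<Rightarrow> 'p vfield" where
  "torsion A D X Y = vf_diff (vf_diff (D X Y) (D Y X)) (vf_bracket A X Y)"

definition torsion_form ::
    "('p::topological_space, 'e::euclidean_space) atlas \<Rightarrow> ('a \<Rightarrow> 'p vfield) \<Rightarrow>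
     ('a \<Rightarrow> 'a \<Rightarrow> real) \<Rightarrow> ('p vfield \<Rightarrow> 'p vfield \<Rightarrow> 'p vfield) \<Rightarrow>
     'p vfield \<Rightarrow> 'p vfield \<Rightarrow> 'p vfield \<Rightarrow> 'p \<Rightarrow> real" where
  "torsion_form A L g D X Y Z p = li_form2 L g (torsion A D X Y) Z p"

definition metric_connection ::
    "('p::topological_space, 'e::euclidean_space) atlas \<Rightarrow> ('a \<Rightarrow> 'p vfield) \<Rightarrow>
     ('a \<Rightarrow> 'a \<Rightarrow> real) \<Rightarrow> ('p vfield \<Rightarrow> 'p vfield \<Rightarrow> 'p vfield) \<Rightarrow> bool" where
  "metric_connection A L g D \<longleftrightarrow>
     affine_connection A D \<and>
     (\<forall>X\<in>vector_fields A. \<forall>Y\<in>vector_fields A. \<forall>Z\<in>vector_fields A. \<forall>p.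
        X p (li_form2 L g Y Z) = li_form2 L g (D X Y) Z p + li_form2 L g Y (D X Z) p)"

text \<open>The torsion form is always tensorial, so being a 3-form amounts to being alternating.\<close>

definition skew_torsion ::
    "('p::topological_space, 'e::euclidean_space) atlas \<Rightarrow> ('a \<Rightarrow> 'p vfield) \<Rightarrow>
     ('a \<Rightarrow> 'a \<Rightarrow> real) \<Rightarrow> ('p vfield \<Rightarrow> 'p vfield \<Rightarrow> 'p vfield) \<Rightarrow> bool" where
  "skew_torsion A L g D \<longleftrightarrow>
     (\<forall>X\<in>vector_fields A. \<forall>Y\<in>vector_fields A. \<forall>Z\<in>vector_fields A. \<forall>p.
        torsion_form A L g D X Y Z p = - torsion_form A L g D Y X Z p \<and>
        torsion_form A L g D X Y Z p = - torsion_form A L g D X Z Y p)"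

definition parallel_endo ::
    "('p::topological_space, 'e::euclidean_space) atlas \<Rightarrow> ('a \<Rightarrow> 'p vfield) \<Rightarrow>
     ('a \<Rightarrow> 'a) \<Rightarrow> ('p vfield \<Rightarrow> 'p vfield \<Rightarrow> 'p vfield) \<Rightarrow> bool" where
  "parallel_endo A L \<phi> D \<longleftrightarrow>
     (\<forall>X\<in>vector_fields A. \<forall>Y\<in>vector_fields A. D X (li_endo L \<phi> Y) = li_endo L \<phi> (D X Y))"

definition canonical_connection ::
    "('p::topological_space, 'e::euclidean_space) atlas \<Rightarrow> ('a \<Rightarrow> 'p vfield) \<Rightarrow>
     (nat \<Rightarrow> 'a \<Rightarrow> 'a) \<Rightarrow> ('a \<Rightarrow> 'a \<Rightarrow> real) \<Rightarrow>
     ('p vfield \<Rightarrow> 'p vfield \<Rightarrow> 'p vfield) \<Rightarrow> bool" where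
  "canonical_connection A L \<phi> g D \<longleftrightarrow>
     metric_connection A L g D \<and> skew_torsion A L g D \<and>
     (\<forall>i\<in>{1,2,3}. parallel_endo A L (\<phi> i) D)"

definition has_torsion_form ::
    "('p::topological_space, 'e::euclidean_space) atlas \<Rightarrow> ('a \<Rightarrow> 'p vfield) \<Rightarrow>
     ('a \<Rightarrow> 'a \<Rightarrow> real) \<Rightarrow> ('a \<Rightarrow> 'a \<Rightarrow> 'a \<Rightarrow> real) \<Rightarrow>
     ('p vfield \<Rightarrow> 'p vfield \<Rightarrow> 'p vfield) \<Rightarrow> bool" where
  "has_torsion_form A L g T D \<longleftrightarrow>
     (\<forall>X\<in>vector_fields A. \<forall>Y\<in>vector_fields A. \<forall>Z\<in>vector_fields A. \<forall>p.
        torsion_form A L g D X Y Z p = li_form3 L T X Y Z p)"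

end

theory Submission
  imports Defs
begin

text \<open>
  Write \<open>H\<close> for the horizontal projection. With \<open>Z = 0\<close> and \<open>\<psi> = 0\<close>, each \<open>ad \<xi>\<^sub>i\<close> vanishes on the
  horizontal space and \<open>[\<xi>\<^sub>j, \<xi>\<^sub>k] = 2\<delta>\<xi>\<^sub>i\<close>; the Jacobi identity and \<open>\<delta> \<noteq> 0\<close> then make the
  horizontal space a subalgebra. A left invariant frame trivialises the tangent bundle, so that a
  connection amounts to a bilinear map \<open>\<Gamma>\<^sub>p\<close> on the Lie algebra for every point \<open>p\<close>, and being
  metric, having skew torsion and preserving \<open>\<phi>\<^sub>i\<close> are pointwise conditions on \<open>\<Gamma>\<^sub>p\<close>. Their only
  solution is the one given by \<open>g(\<Gamma>(X, Y), Z) = - g([HY, HZ], X)\<close>: the difference of two solutions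
  is a 3-form from which \<open>\<phi>\<^sub>i\<close> in one slot can be moved to any other slot at the cost of a sign,
  hence it vanishes.
\<close>

section \<open>Functions of class \<open>C\<^sup>k\<close>\<close>

text \<open>Origin of the coefficient -2\<delta>: \<open>\<Gamma> x y\<close> vanishes as soon as
  \<open>y\<close> is vertical, so on vertical vectors the torsion is minus the bracket, and
  \<open>br (\<xi> j) (\<xi> k) = (2 * \<delta>) *\<^sub>R \<xi> i\<close>. Origin of the formula
  for \<Gamma>: on the horizontal space the abelian condition moves \<open>\<phi> i\<close> across
  the bracket with a sign (\<open>br_phi_horizontal\<close>), and g moves it with a sign too
  (\<open>g_phi\<close>); the two signs cancel, which is why this \<Gamma> commutes with
  \<open>\<phi> i\<close>. The obstacle is analytic. Replacing fields by functions with values in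
  the Lie algebra requires that \<open>maurer_cartan L X\<close> be smooth. In a chart this function
  solves a linear system whose columns are the frame fields, so the inverse of a smooth family of
  matrices has to be shown smooth; the C^k calculus serves this purpose. Once that is done, the
  coefficient functions live on the whole manifold, and the axioms of a connection apply to them
  without cut-off functions.\<close>

lemma Ck_on_cong:
  assumes "open S" and "\<And>x. x \<in> S \<Longrightarrow> f x = g x" and "Ck_on k S f"
  shows "Ck_on k S g"
  using assms(2,3)
proof (induction k arbitrary: f g)
  case 0
  then show ?case using continuous_on_cong by fastforce
next
  case (Suc k)
  have d: "f differentiable (at x)" if "x \<in> S" for x using Suc.prems that by simp
  have eq: "frechet_derivative f (at x) = frechet_derivative g (at x)" if "x \<in> S" for x
    using frechet_derivative_transform_within_open[OF d[OF that] assms(1) that] Suc.prems(1) by blast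
  have "g differentiable (at x)" if x: "x \<in> S" for x
  proof -
    have "(g has_derivative frechet_derivative f (at x)) (at x)"
      using d[OF x] unfolding frechet_derivative_works
      by (rule has_derivative_transform_within_open[OF _ assms(1) x Suc.prems(1)])
    then show ?thesis unfolding differentiable_def by blast
  qed
  moreover have "Ck_on k S (\<lambda>x. frechet_derivative g (at x) v)" for v
    using Suc.prems(2) by (rule_tac Suc.IH[of "\<lambda>x. frechet_derivative f (at x) v"]) (simp_all add: eq)
  ultimately show ?case by simp
qed

text \<open>Any explicit family of derivatives may replace \<open>frechet_derivative\<close>, so the
  closure properties below follow from the usual differentiation rules by induction on k.\<close>

lemma Ck_on_SucI:
  assumes "open S" and "\<And>x. x \<in> S \<Longrightarrow> (f has_derivative f' x) (at x)"
    and "\<And>v. Ck_on k S (\<lambda>x. f' x v)"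
  shows "Ck_on (Suc k) S f"
proof -
  have "f' x = frechet_derivative f (at x)" if "x \<in> S" for x
    using assms(2)[OF that] by (rule frechet_derivative_at)
  then have "Ck_on k S (\<lambda>x. frechet_derivative f (at x) v)" for v
    by (intro Ck_on_cong[OF assms(1) _ assms(3)[of v]]) simp
  then show ?thesis using assms(2) unfolding Ck_on.simps differentiable_def by blast
qed

lemma Ck_on_has_derivative:
  assumes "Ck_on (Suc k) S f" and "x \<in> S"
  shows "(f has_derivative frechet_derivative f (at x)) (at x)"
  using assms frechet_derivative_works by auto

lemma Ck_on_SucD: "Ck_on (Suc k) S f \<Longrightarrow> Ck_on k S f"
proof (induction k arbitrary: f)
  case 0
  then show ?case
    by (auto intro!: continuous_at_imp_continuous_on differentiable_imp_continuous_within)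
next
  case (Suc k)
  then show ?case by (metis Ck_on.simps(2))
qed

lemma Ck_on_subset: "Ck_on k S f \<Longrightarrow> T \<subseteq> S \<Longrightarrow> Ck_on k T f"
  by (induction k arbitrary: f) (auto intro: continuous_on_subset)

lemma Ck_on_const: "open S \<Longrightarrow> Ck_on k S (\<lambda>_. a)"
  by (induction k arbitrary: a) (auto intro!: Ck_on_SucI has_derivative_const)

lemma Ck_on_bounded_linear:
  assumes "open S" and "bounded_linear l" and "Ck_on k S f"
  shows "Ck_on k S (\<lambda>x. l (f x))"
  using assms(3)
proof (induction k arbitrary: f)
  case 0
  then show ?case using assms(2) by (simp add: bounded_linear.continuous_on)
next
  case (Suc k)
  show ?case
  proof (rule Ck_on_SucI[OF assms(1)])
    show "((\<lambda>x. l (f x)) has_derivative (\<lambda>v. l (frechet_derivative f (at x) v))) (at x)"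
      if "x \<in> S" for x
      by (rule bounded_linear.has_derivative[OF assms(2) Ck_on_has_derivative[OF Suc.prems that]])
    show "Ck_on k S (\<lambda>x. l (frechet_derivative f (at x) v))" for v
      using Suc.prems by (rule_tac Suc.IH) simp
  qed
qed

lemma Ck_on_add:
  assumes "open S" and "Ck_on k S f" and "Ck_on k S g"
  shows "Ck_on k S (\<lambda>x. f x + g x)"
  using assms(2,3)
proof (induction k arbitrary: f g)
  case 0
  then show ?case by (simp add: continuous_on_add)
next
  case (Suc k)
  show ?case
  proof (rule Ck_on_SucI[OF assms(1)])
    show "((\<lambda>x. f x + g x) has_derivative
        (\<lambda>v. frechet_derivative f (at x) v + frechet_derivative g (at x) v)) (at x)"
      if "x \<in> S" for x
      using Ck_on_has_derivative[OF Suc.prems(1) that] Ck_on_has_derivative[OF Suc.prems(2) that]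
      by (rule has_derivative_add)
    show "Ck_on k S (\<lambda>x. frechet_derivative f (at x) v + frechet_derivative g (at x) v)" for v
      using Suc.prems by (rule_tac Suc.IH) simp_all
  qed
qed

lemma Ck_on_sum:
  assumes "open S" and "\<And>i. i \<in> I \<Longrightarrow> Ck_on k S (f i)"
  shows "Ck_on k S (\<lambda>x. \<Sum>i\<in>I. f i x)"
  using assms(2)
proof (induction I rule: infinite_finite_induct)
  case (insert i I)
  then have "Ck_on k S (\<lambda>x. f i x + (\<Sum>i\<in>I. f i x))" by (intro Ck_on_add[OF assms(1)]) auto
  then show ?case using insert by simp
qed (auto intro: Ck_on_const[OF assms(1)])

lemma Ck_on_bounded_bilinear:
  assumes "open S" and "bounded_bilinear h" and "Ck_on k S f" and "Ck_on k S g"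
  shows "Ck_on k S (\<lambda>x. h (f x) (g x))"
  using assms(3,4)
proof (induction k arbitrary: f g)
  case 0
  then show ?case using bounded_bilinear.continuous_on[OF assms(2)] by simp
next
  case (Suc k)
  show ?case
  proof (rule Ck_on_SucI[OF assms(1)])
    show "((\<lambda>x. h (f x) (g x)) has_derivative
        (\<lambda>v. h (f x) (frechet_derivative g (at x) v) + h (frechet_derivative f (at x) v) (g x)))
        (at x)" if "x \<in> S" for x
      using Ck_on_has_derivative[OF Suc.prems(1) that] Ck_on_has_derivative[OF Suc.prems(2) that]
      by (rule bounded_bilinear.FDERIV[OF assms(2)])
    show "Ck_on k S (\<lambda>x. h (f x) (frechet_derivative g (at x) v) +
        h (frechet_derivative f (at x) v) (g x))" for v
      \<comment> \<open>The product rule leaves one factor of each summand undifferentiated. That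
        factor has to be lowered to class C^k before the induction hypothesis applies.\<close>
      using Suc.prems Suc.prems[THEN Ck_on_SucD]
      by (rule_tac Ck_on_add[OF assms(1)]; rule_tac Suc.IH) simp_all
  qed
qed

section \<open>Linear systems with smooth coefficients\<close>

lemma linear_sum_Basis: "linear (\<lambda>v. \<Sum>b\<in>Basis. (v \<bullet> b) *\<^sub>R m b)"
  by (rule linearI) (simp_all add: inner_add_left scaleR_add_left sum.distrib scaleR_sum_right)

text \<open>
  Differentiability of the inverse matrix without determinants: the map
  \<open>(x, u) \<mapsto> (x, M x u)\<close> has an invertible derivative.
\<close>

lemma linear_system_differentiable:
  fixes m :: "'b::euclidean_space \<Rightarrow> 'a::euclidean_space \<Rightarrow> 'b" and u w :: "'a \<Rightarrow> 'b"
  defines "M \<equiv> \<lambda>x v. \<Sum>b\<in>Basis. (v \<bullet> b) *\<^sub>R m b x"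
  assumes S: "open S" "x \<in> S"
    and m: "\<And>b x. b \<in> Basis \<Longrightarrow> x \<in> S \<Longrightarrow> m b differentiable (at x)"
    and w: "w differentiable (at x)"
    and inj: "\<And>x. x \<in> S \<Longrightarrow> inj (M x)"
    and sol: "\<And>x. x \<in> S \<Longrightarrow> M x (u x) = w x"
  shows "u differentiable (at x)"
proof -
  have lin: "linear (M x)" for x
    unfolding M_def by (rule linear_sum_Basis)
  define F where "F = (\<lambda>(x, v). (x, M x v))"
  define N where "N = (\<lambda>x. inv_into UNIV (M x))"
  define G where "G = (\<lambda>(x, v). (x, N x v))"
  have bij: "bij (M x)" if "x \<in> S" for x
    using linear_injective_imp_surjective[OF lin inj[OF that]] inj[OF that] by (simp add: bij_def)
  have N: "N x (M x v) = v" "M x (N x v) = v" if "x \<in> S" for x v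
    using bij[OF that] unfolding N_def by (simp_all add: bij_is_inj bij_is_surj surj_f_inv_f)
  have Nlin: "linear (N x)" if "x \<in> S" for x
    using N[OF that] lin[of x] by (metis (no_types, lifting) linear_add linear_scale linearI)
  define m' where "m' = (\<lambda>b x. frechet_derivative (m b) (at x))"
  have dm: "(m b has_derivative m' b x) (at x)" if "b \<in> Basis" "x \<in> S" for b x
    using m[OF that] unfolding m'_def frechet_derivative_works .
  define F' where "F' = (\<lambda>(x, v) (h, l). (h, (\<Sum>b\<in>Basis. (v \<bullet> b) *\<^sub>R m' b x h) + M x l))"
  have dF: "(F has_derivative F' z) (at z)" if z: "z \<in> S \<times> UNIV" for z
  proof -
    have *: "((\<lambda>z. (snd z \<bullet> b) *\<^sub>R m b (fst z)) has_derivative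
        (\<lambda>hl. (snd z \<bullet> b) *\<^sub>R m' b (fst z) (fst hl) + (snd hl \<bullet> b) *\<^sub>R m b (fst z))) (at z)"
      if b: "b \<in> Basis" for b
    proof -
      have 1: "((\<lambda>z. m b (fst z)) has_derivative (\<lambda>hl. m' b (fst z) (fst hl))) (at z)"
        using has_derivative_compose[OF has_derivative_fst[OF has_derivative_ident] dm[OF b]] z
        by auto
      show ?thesis
        by (rule has_derivative_scaleR[OF _ 1]) (auto intro!: derivative_eq_intros)
    qed
    have "((\<lambda>z. \<Sum>b\<in>Basis. (snd z \<bullet> b) *\<^sub>R m b (fst z)) has_derivative
        (\<lambda>hl. \<Sum>b\<in>Basis. (snd z \<bullet> b) *\<^sub>R m' b (fst z) (fst hl) + (snd hl \<bullet> b) *\<^sub>R m b (fst z)))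
        (at z)"
      by (rule has_derivative_sum) (rule *)
    then have "((\<lambda>z. (fst z, \<Sum>b\<in>Basis. (snd z \<bullet> b) *\<^sub>R m b (fst z))) has_derivative
        (\<lambda>hl. (fst hl, \<Sum>b\<in>Basis. (snd z \<bullet> b) *\<^sub>R m' b (fst z) (fst hl) +
          (snd hl \<bullet> b) *\<^sub>R m b (fst z)))) (at z)"
      by (intro has_derivative_Pair has_derivative_fst has_derivative_ident)
    then show ?thesis
      unfolding F_def F'_def M_def by (simp add: case_prod_beta' sum.distrib)
  qed
  define z where "z = (x, u x)"
  have z: "z \<in> S \<times> UNIV" using S unfolding z_def by simp
  \<comment> \<open>Inverse of the block triangular map \<open>F' z\<close>: the component
    \<open>h\<close> is kept, and its contribution to the second component is subtracted before
    \<open>N x\<close> is applied.\<close>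
  define G' where "G' = (\<lambda>(h, l). (h, N x (l - (\<Sum>b\<in>Basis. (u x \<bullet> b) *\<^sub>R m' b x h))))"
  have "(G has_derivative G') (at (F z))"
  \<comment> \<open>This form of the inverse function theorem asks for no continuity of
    \<open>G\<close>. It needs a left inverse on an open set, continuity of \<open>F\<close> there,
    and a right inverse of the derivative at the single point \<open>z\<close>.\<close>
  proof (rule has_derivative_inverse_strong[OF _ z])
    show "open (S \<times> (UNIV :: 'b set))" using S(1) by (intro open_Times) auto
    show "continuous_on (S \<times> UNIV) F"
      using dF has_derivative_continuous by (intro continuous_at_imp_continuous_on) blast
    show "G (F z) = z" if "z \<in> S \<times> UNIV" for z
      using that N unfolding G_def F_def by auto
    show "(F has_derivative F' z) (at z)" by (rule dF[OF z])
    show "F' z \<circ> G' = id" using N[OF S(2)] unfolding F'_def G'_def z_def by auto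
  qed
  moreover have "F z = (x, w x)" unfolding F_def z_def using sol S by simp
  ultimately have "G differentiable (at (x, w x))" unfolding differentiable_def by auto
  then have "(\<lambda>x. G (x, w x)) differentiable (at x)"
    using w by (intro differentiable_compose[of G "\<lambda>x. (x, w x)"] differentiable_Pair) auto
  then have "(\<lambda>x. snd (G (x, w x))) differentiable (at x)"
    using has_derivative_snd unfolding differentiable_def by blast
  moreover have "snd (G (y, w y)) = u y" if "y \<in> S" for y
    using sol[OF that] N(1)[OF that] unfolding G_def by (metis case_prod_conv snd_conv)
  ultimately show ?thesis
    using has_derivative_transform_within_open[OF _ S] unfolding differentiable_def by blast
qed

text \<open>Bootstrapping: the columns \<open>N b\<close> of the inverse matrix are differentiable
  by the previous lemma with constant right-hand side, and their derivatives are polynomial in the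
  columns and the derivatives of \<open>m\<close>. So if all columns are of class C^k, they are of
  class C^(k+1). The solution \<open>u\<close> is a combination of the columns with the components
  of \<open>w\<close> as coefficients.\<close>

lemma linear_system_smooth_on:
  fixes m :: "'b::euclidean_space \<Rightarrow> 'a::euclidean_space \<Rightarrow> 'b" and u w :: "'a \<Rightarrow> 'b"
  defines "M \<equiv> \<lambda>x v. \<Sum>b\<in>Basis. (v \<bullet> b) *\<^sub>R m b x"
  assumes S: "open S"
    and m: "\<And>b. b \<in> Basis \<Longrightarrow> smooth_on S (m b)"
    and w: "smooth_on S w"
    and inj: "\<And>x. x \<in> S \<Longrightarrow> inj (M x)"
    and sol: "\<And>x. x \<in> S \<Longrightarrow> M x (u x) = w x"
  shows "smooth_on S u"
proof -
  have lin: "linear (M x)" for x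
    unfolding M_def by (rule linear_sum_Basis)
  define N where "N = (\<lambda>b x. inv_into UNIV (M x) b)"
  have MN: "M x (N b x) = b" if "x \<in> S" for x b
    using linear_injective_imp_surjective[OF lin inj[OF that]] unfolding N_def
    by (simp add: surj_f_inv_f)
  have expand: "v = (\<Sum>b\<in>Basis. (M x v \<bullet> b) *\<^sub>R N b x)" if "x \<in> S" for x v
  proof (rule injD[OF inj[OF that]])
    show "M x v = M x (\<Sum>b\<in>Basis. (M x v \<bullet> b) *\<^sub>R N b x)"
      using MN[OF that] by (simp add: linear_sum[OF lin] linear_scale[OF lin] euclidean_representation)
  qed
  define m' where "m' = (\<lambda>b x. frechet_derivative (m b) (at x))"
  have m1: "Ck_on (Suc k) S (m b)" if "b \<in> Basis" for b k
    using m[OF that] by (simp add: smooth_on_def)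
  have dm: "(m b has_derivative m' b x) (at x)" if "b \<in> Basis" "x \<in> S" for b x
    using m1[OF that(1)] that(2) unfolding m'_def by (rule Ck_on_has_derivative)
  define N' where "N' = (\<lambda>b x. frechet_derivative (N b) (at x))"
  have dN: "(N b has_derivative N' b x) (at x)" if x: "x \<in> S" for b x
  proof -
    have "N b differentiable (at x)"
    proof (rule linear_system_differentiable[OF S x])
      show "m d differentiable (at x)" if "d \<in> Basis" "x \<in> S" for d x
        using dm[OF that] differentiable_def by blast
      show "(\<lambda>_. b) differentiable (at x)" by simp
    qed (use inj MN in \<open>simp_all add: M_def\<close>)
    then show ?thesis unfolding N'_def frechet_derivative_works .
  qed
  \<comment> \<open>Differentiate \<open>M x (N b x) = b\<close>, which is constant on S, and solve
    for the derivative of \<open>N b\<close> with \<open>expand\<close>. This is the rule (M^-1)' =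
    - M^-1 M' M^-1, column by column.\<close>
  have N'_eq: "N' b x v =
      (\<Sum>c\<in>Basis. (- (\<Sum>d\<in>Basis. (N b x \<bullet> d) *\<^sub>R m' d x v) \<bullet> c) *\<^sub>R N c x)"
    if x: "x \<in> S" for b x v
  proof -
    have "((\<lambda>x. M x (N b x)) has_derivative
        (\<lambda>v. \<Sum>d\<in>Basis. (N b x \<bullet> d) *\<^sub>R m' d x v + (N' b x v \<bullet> d) *\<^sub>R m d x)) (at x)"
      unfolding M_def
      by (rule has_derivative_sum, rule has_derivative_scaleR[OF _ dm[OF _ x]])
        (auto intro!: derivative_eq_intros dN[OF x])
    moreover have "((\<lambda>x. M x (N b x)) has_derivative (\<lambda>_. 0)) (at x)"
      by (rule has_derivative_transform_within_open[OF has_derivative_const[of b] S x]) (simp add: MN)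
    ultimately have "(\<lambda>v. \<Sum>d\<in>Basis. (N b x \<bullet> d) *\<^sub>R m' d x v + (N' b x v \<bullet> d) *\<^sub>R m d x) = (\<lambda>_. 0)"
      by (rule has_derivative_unique)
    then have "(\<Sum>d\<in>Basis. (N b x \<bullet> d) *\<^sub>R m' d x v) + M x (N' b x v) = 0"
      unfolding M_def sum.distrib[symmetric] by (rule fun_cong)
    then have "M x (N' b x v) = - (\<Sum>d\<in>Basis. (N b x \<bullet> d) *\<^sub>R m' d x v)"
      by (simp add: eq_neg_iff_add_eq_0 add.commute)
    then show ?thesis using expand[OF x, of "N' b x v"] by simp
  qed
  have N: "Ck_on k S (N b)" for k b
  proof (induction k arbitrary: b)
    case 0
    show ?case
      using has_derivative_continuous[OF dN]
      by (auto intro: continuous_at_imp_continuous_on)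
  next
    case (Suc k)
    show ?case
    proof (rule Ck_on_SucI[OF S])
      show "(N b has_derivative N' b x) (at x)" if "x \<in> S" for x by (rule dN[OF that])
      fix v
      have "Ck_on k S (\<lambda>x. m' d x v)" if "d \<in> Basis" for d
        using m1[OF that, of k] unfolding m'_def by simp
      then have "Ck_on k S (\<lambda>x. \<Sum>d\<in>Basis. (N b x \<bullet> d) *\<^sub>R m' d x v)"
        by (intro Ck_on_sum[OF S] Ck_on_bounded_bilinear[OF S bounded_bilinear_scaleR]
            Ck_on_bounded_linear[OF S bounded_linear_inner_left] Suc.IH)
      then have "Ck_on k S (\<lambda>x. - (\<Sum>d\<in>Basis. (N b x \<bullet> d) *\<^sub>R m' d x v))"
        by (rule Ck_on_bounded_linear[OF S bounded_linear_minus[OF bounded_linear_ident]])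
      then have "Ck_on k S (\<lambda>x. \<Sum>c\<in>Basis.
          (- (\<Sum>d\<in>Basis. (N b x \<bullet> d) *\<^sub>R m' d x v) \<bullet> c) *\<^sub>R N c x)"
        by (intro Ck_on_sum[OF S] Ck_on_bounded_bilinear[OF S bounded_bilinear_scaleR]
            Ck_on_bounded_linear[OF S bounded_linear_inner_left] Suc.IH)
      then show "Ck_on k S (\<lambda>x. N' b x v)"
        by (rule Ck_on_cong[OF S, rotated]) (simp only: N'_eq)
    qed
  qed
  have "Ck_on k S u" for k
  proof (rule Ck_on_cong[OF S])
    show "(\<Sum>b\<in>Basis. (w x \<bullet> b) *\<^sub>R N b x) = u x" if "x \<in> S" for x
      using expand[OF that, of "u x"] sol[OF that] by simp
    show "Ck_on k S (\<lambda>x. \<Sum>b\<in>Basis. (w x \<bullet> b) *\<^sub>R N b x)"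
      using w N unfolding smooth_on_def
      by (intro Ck_on_sum[OF S] Ck_on_bounded_bilinear[OF S bounded_bilinear_scaleR]
          Ck_on_bounded_linear[OF S bounded_linear_inner_left]) auto
  qed
  then show ?thesis by (simp add: smooth_on_def)
qed

section \<open>Smooth functions and tangent vectors\<close>

text \<open>Vector-valued version of \<open>smooth_fun_on\<close>; charts and the functions
  \<open>maurer_cartan L X\<close> are treated as single maps rather than as lists of
  components.\<close>

definition smooth_into ::
    "('p::topological_space, 'e::euclidean_space) atlas \<Rightarrow> 'p set \<Rightarrow>
     ('p \<Rightarrow> 'b::real_normed_vector) \<Rightarrow> bool" where
  "smooth_into A W F \<longleftrightarrow> (\<forall>(U, c)\<in>A. smooth_on (c ` (U \<inter> W)) (F \<circ> inv_into U c))"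

lemma smooth_fun_on_iff: "smooth_fun_on A W f \<longleftrightarrow> smooth_into A W f"
  by (simp add: smooth_fun_on_def smooth_into_def)

text \<open>Extends a tangent vector from real to vector-valued functions. For a chart
  \<open>c\<close>, the value \<open>tangent_deriv v c\<close> is the coordinate vector of
  \<open>v\<close>.\<close>

definition tangent_deriv :: "(('p \<Rightarrow> real) \<Rightarrow> real) \<Rightarrow> ('p \<Rightarrow> 'b::euclidean_space) \<Rightarrow> 'b" where
  "tangent_deriv v F = (\<Sum>b\<in>Basis. v (\<lambda>q. F q \<bullet> b) *\<^sub>R b)"

lemma tangent_deriv_real: "tangent_deriv v f = v f"
  by (simp add: tangent_deriv_def)

lemma tangent_deriv_inner: "b \<in> Basis \<Longrightarrow> tangent_deriv v F \<bullet> b = v (\<lambda>q. F q \<bullet> b)"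
  unfolding tangent_deriv_def by (simp add: inner_sum_left inner_Basis if_distrib cong: if_cong)

locale manifold =
  fixes A :: "('p::topological_space, 'e::euclidean_space) atlas"
  assumes atlas: "smooth_atlas A"
begin

lemma chart:
  assumes "(U, c) \<in> A"
  shows "open U" "open (c ` U)" "homeomorphism U (c ` U) c (inv_into U c)"
    "p \<in> U \<Longrightarrow> inv_into U c (c p) = p"
  using atlas assms unfolding smooth_atlas_def homeomorphism_def by fast+

lemma chart_exists: obtains U c where "(U, c) \<in> A" "p \<in> U"
proof -
  have "p \<in> (\<Union>(U, c)\<in>A. U)" using atlas unfolding smooth_atlas_def by blast
  then show ?thesis using that by auto
qed

lemma chart_change:
  assumes "(U, c) \<in> A" and "(V, d) \<in> A"
  shows "smooth_on (c ` (U \<inter> V)) (d \<circ> inv_into U c)"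
  using atlas assms unfolding smooth_atlas_def by fast

lemma open_chart_image:
  assumes "(U, c) \<in> A" and "open W"
  shows "open (c ` (U \<inter> W))"
proof -
  have "c ` (U \<inter> W) = c ` U \<inter> inv_into U c -` W" using chart(4)[OF assms(1)] by auto
  then show ?thesis
    using chart(2,3)[OF assms(1)] assms(2)
    by (simp add: continuous_open_preimage homeomorphism_cont2)
qed

lemma smooth_intoI:
  "(\<And>U c k. (U, c) \<in> A \<Longrightarrow> Ck_on k (c ` (U \<inter> W)) (\<lambda>y. F (inv_into U c y))) \<Longrightarrow> smooth_into A W F"
  by (auto simp: smooth_into_def smooth_on_def o_def)

lemma smooth_intoD:
  "smooth_into A W F \<Longrightarrow> (U, c) \<in> A \<Longrightarrow> Ck_on k (c ` (U \<inter> W)) (\<lambda>y. F (inv_into U c y))"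
  by (auto simp: smooth_into_def smooth_on_def o_def)

lemma smooth_into_subset: "smooth_into A W F \<Longrightarrow> W' \<subseteq> W \<Longrightarrow> smooth_into A W' F"
  by (rule smooth_intoI) (rule Ck_on_subset[OF smooth_intoD], auto)

lemma smooth_into_const: "open W \<Longrightarrow> smooth_into A W (\<lambda>_. a)"
  by (rule smooth_intoI) (rule Ck_on_const[OF open_chart_image])

lemma smooth_into_bounded_linear:
  "open W \<Longrightarrow> bounded_linear l \<Longrightarrow> smooth_into A W F \<Longrightarrow> smooth_into A W (\<lambda>p. l (F p))"
  by (rule smooth_intoI) (rule Ck_on_bounded_linear[OF open_chart_image _ smooth_intoD])

lemma smooth_into_bounded_bilinear:
  "open W \<Longrightarrow> bounded_bilinear h \<Longrightarrow> smooth_into A W F \<Longrightarrow> smooth_into A W G \<Longrightarrow>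
    smooth_into A W (\<lambda>p. h (F p) (G p))"
  by (rule smooth_intoI) (rule Ck_on_bounded_bilinear[OF open_chart_image _ smooth_intoD smooth_intoD])

lemma smooth_into_add:
  "open W \<Longrightarrow> smooth_into A W F \<Longrightarrow> smooth_into A W G \<Longrightarrow> smooth_into A W (\<lambda>p. F p + G p)"
  by (rule smooth_intoI) (rule Ck_on_add[OF open_chart_image smooth_intoD smooth_intoD])

lemma smooth_into_sum:
  assumes "open W" and "\<And>i. i \<in> I \<Longrightarrow> smooth_into A W (F i)"
  shows "smooth_into A W (\<lambda>p. \<Sum>i\<in>I. F i p)"
  using assms(2)
proof (induction I rule: infinite_finite_induct)
  case (insert i I)
  then have "smooth_into A W (\<lambda>p. F i p + (\<Sum>i\<in>I. F i p))"
    by (intro smooth_into_add[OF assms(1)]) auto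
  then show ?case using insert by simp
qed (auto intro: smooth_into_const[OF assms(1)])

lemma smooth_into_components:
  fixes F :: "'p \<Rightarrow> 'b::euclidean_space"
  assumes "open W" and "\<And>b. b \<in> Basis \<Longrightarrow> smooth_into A W (\<lambda>p. F p \<bullet> b)"
  shows "smooth_into A W F"
proof -
  have "smooth_into A W (\<lambda>p. \<Sum>b\<in>Basis. (F p \<bullet> b) *\<^sub>R b)"
    using assms(2) by (intro smooth_into_sum[OF assms(1)]
        smooth_into_bounded_linear[OF assms(1) bounded_linear_scaleR_left])
  then show ?thesis by (simp add: euclidean_representation)
qed

lemma smooth_into_inner: "open W \<Longrightarrow> smooth_into A W F \<Longrightarrow> smooth_into A W (\<lambda>p. F p \<bullet> b)"
  by (rule smooth_into_bounded_linear[OF _ bounded_linear_inner_left])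

lemma smooth_near_iff: "smooth_near A p f \<longleftrightarrow> (\<exists>W. open W \<and> p \<in> W \<and> smooth_into A W f)"
  by (simp add: smooth_near_def smooth_fun_on_iff)

lemma smooth_nearI: "open W \<Longrightarrow> p \<in> W \<Longrightarrow> smooth_into A W f \<Longrightarrow> smooth_near A p f"
  unfolding smooth_near_iff by blast

lemma smooth_into_chart:
  assumes "(U, c) \<in> A"
  shows "smooth_into A U c"
  using assms chart_change unfolding smooth_into_def by blast

lemma smooth_into_differentiable:
  assumes "smooth_into A W F" and "p \<in> W" and "(U, c) \<in> A" and "p \<in> U"
  shows "F \<circ> inv_into U c differentiable (at (c p))"
proof -
  have "Ck_on (Suc 0) (c ` (U \<inter> W)) (F \<circ> inv_into U c)"
    using assms(1,3) unfolding smooth_into_def smooth_on_def by blast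
  then show ?thesis using assms(2,4) by simp
qed

section \<open>Tangent vectors computed in charts\<close>

definition chart_vector where
  "chart_vector U c p w =
     (\<lambda>f. if smooth_near A p f then frechet_derivative (f \<circ> inv_into U c) (at (c p)) w else 0)"

lemma tangent_space_iff:
  "v \<in> tangent_space A p \<longleftrightarrow> (\<exists>U c w. (U, c) \<in> A \<and> p \<in> U \<and> v = chart_vector U c p w)"
  unfolding tangent_space_def chart_vector_def by blast

text \<open>Since every component of \<open>F\<close> is smooth near p, the guard in
  \<open>chart_vector\<close> is true. Through this identity the rules for derivatives become rules
  for tangent vectors.\<close>

lemma tangent_deriv_chart_vector:
  fixes F :: "'p \<Rightarrow> 'b::euclidean_space"
  assumes "(U, c) \<in> A" "p \<in> U" and "open W" "p \<in> W" "smooth_into A W F"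
  shows "tangent_deriv (chart_vector U c p w) F = frechet_derivative (F \<circ> inv_into U c) (at (c p)) w"
proof (rule euclidean_eqI)
  fix b :: 'b assume b: "b \<in> Basis"
  have n: "smooth_near A p (\<lambda>q. F q \<bullet> b)"
    by (rule smooth_nearI[OF assms(3,4) smooth_into_inner[OF assms(3,5)]])
  have "(F \<circ> inv_into U c has_derivative frechet_derivative (F \<circ> inv_into U c) (at (c p))) (at (c p))"
    using smooth_into_differentiable[OF assms(5,4,1,2)] unfolding frechet_derivative_works .
  then have "((\<lambda>y. (F \<circ> inv_into U c) y \<bullet> b) has_derivative
      (\<lambda>w. frechet_derivative (F \<circ> inv_into U c) (at (c p)) w \<bullet> b)) (at (c p))"
    by (rule has_derivative_inner_left)
  then have "frechet_derivative ((\<lambda>q. F q \<bullet> b) \<circ> inv_into U c) (at (c p)) =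
      (\<lambda>w. frechet_derivative (F \<circ> inv_into U c) (at (c p)) w \<bullet> b)"
    by (subst frechet_derivative_at) (simp_all add: o_def)
  then show "tangent_deriv (chart_vector U c p w) F \<bullet> b =
      frechet_derivative (F \<circ> inv_into U c) (at (c p)) w \<bullet> b"
    using n by (simp add: tangent_deriv_inner[OF b] chart_vector_def)
qed

lemma tangent_not_smooth: "v \<in> tangent_space A p \<Longrightarrow> \<not> smooth_near A p f \<Longrightarrow> v f = 0"
  by (auto simp: tangent_space_iff chart_vector_def)

lemma tangent_deriv_bounded_linear:
  fixes F :: "'p \<Rightarrow> 'b::euclidean_space" and l :: "'b \<Rightarrow> 'c::euclidean_space"
  assumes "v \<in> tangent_space A p" and W: "open W" "p \<in> W" and F: "smooth_into A W F"
    and l: "bounded_linear l"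
  shows "tangent_deriv v (\<lambda>q. l (F q)) = l (tangent_deriv v F)"
proof -
  obtain U c w where U: "(U, c) \<in> A" "p \<in> U" and v: "v = chart_vector U c p w"
    using assms(1) unfolding tangent_space_iff by blast
  have "(F \<circ> inv_into U c has_derivative frechet_derivative (F \<circ> inv_into U c) (at (c p))) (at (c p))"
    using smooth_into_differentiable[OF F W(2) U] unfolding frechet_derivative_works .
  then have "((\<lambda>q. l (F q)) \<circ> inv_into U c has_derivative
      (\<lambda>w. l (frechet_derivative (F \<circ> inv_into U c) (at (c p)) w))) (at (c p))"
    using bounded_linear.has_derivative[OF l] by (simp add: o_def)
  from frechet_derivative_at[OF this, symmetric] show ?thesis
    unfolding v tangent_deriv_chart_vector[OF U W F]
      tangent_deriv_chart_vector[OF U W smooth_into_bounded_linear[OF W(1) l F]]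
    by simp
qed

lemma tangent_deriv_bounded_bilinear:
  fixes F :: "'p \<Rightarrow> 'b::euclidean_space" and G :: "'p \<Rightarrow> 'c::euclidean_space"
    and h :: "'b \<Rightarrow> 'c \<Rightarrow> 'd::euclidean_space"
  assumes "v \<in> tangent_space A p" and W: "open W" "p \<in> W" and F: "smooth_into A W F"
    and G: "smooth_into A W G" and h: "bounded_bilinear h"
  shows "tangent_deriv v (\<lambda>q. h (F q) (G q)) = h (F p) (tangent_deriv v G) + h (tangent_deriv v F) (G p)"
proof -
  obtain U c w where U: "(U, c) \<in> A" "p \<in> U" and v: "v = chart_vector U c p w"
    using assms(1) unfolding tangent_space_iff by blast
  have "(F \<circ> inv_into U c has_derivative frechet_derivative (F \<circ> inv_into U c) (at (c p))) (at (c p))"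
    "(G \<circ> inv_into U c has_derivative frechet_derivative (G \<circ> inv_into U c) (at (c p))) (at (c p))"
    using smooth_into_differentiable[OF F W(2) U] smooth_into_differentiable[OF G W(2) U]
    unfolding frechet_derivative_works .
  from bounded_bilinear.FDERIV[OF h this]
  have "((\<lambda>q. h (F q) (G q)) \<circ> inv_into U c has_derivative
      (\<lambda>w. h (F p) (frechet_derivative (G \<circ> inv_into U c) (at (c p)) w) +
        h (frechet_derivative (F \<circ> inv_into U c) (at (c p)) w) (G p))) (at (c p))"
    by (simp add: o_def chart(4)[OF U])
  from frechet_derivative_at[OF this, symmetric] show ?thesis
    unfolding v tangent_deriv_chart_vector[OF U W F] tangent_deriv_chart_vector[OF U W G]
      tangent_deriv_chart_vector[OF U W smooth_into_bounded_bilinear[OF W(1) h F G]]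
    by simp
qed

lemma tangent_deriv_add:
  fixes F G :: "'p \<Rightarrow> 'b::euclidean_space"
  assumes "v \<in> tangent_space A p" and W: "open W" "p \<in> W" and F: "smooth_into A W F"
    and G: "smooth_into A W G"
  shows "tangent_deriv v (\<lambda>q. F q + G q) = tangent_deriv v F + tangent_deriv v G"
proof -
  obtain U c w where U: "(U, c) \<in> A" "p \<in> U" and v: "v = chart_vector U c p w"
    using assms(1) unfolding tangent_space_iff by blast
  have "(F \<circ> inv_into U c has_derivative frechet_derivative (F \<circ> inv_into U c) (at (c p))) (at (c p))"
    "(G \<circ> inv_into U c has_derivative frechet_derivative (G \<circ> inv_into U c) (at (c p))) (at (c p))"
    using smooth_into_differentiable[OF F W(2) U] smooth_into_differentiable[OF G W(2) U]
    unfolding frechet_derivative_works .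
  from has_derivative_add[OF this]
  have "((\<lambda>q. F q + G q) \<circ> inv_into U c has_derivative
      (\<lambda>w. frechet_derivative (F \<circ> inv_into U c) (at (c p)) w +
        frechet_derivative (G \<circ> inv_into U c) (at (c p)) w)) (at (c p))"
    by (simp add: o_def)
  from frechet_derivative_at[OF this, symmetric] show ?thesis
    unfolding v tangent_deriv_chart_vector[OF U W F] tangent_deriv_chart_vector[OF U W G]
      tangent_deriv_chart_vector[OF U W smooth_into_add[OF W(1) F G]]
    by simp
qed

text \<open>The derivation argument: the product rule for 1 * 1 makes the derivative of 1 equal to
  twice itself. Every other constant is the image of 1 under a linear map.\<close>

lemma tangent_deriv_const:
  fixes a :: "'b::euclidean_space"
  assumes "v \<in> tangent_space A p"
  shows "tangent_deriv v (\<lambda>_. a) = 0"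
proof -
  have "tangent_deriv v (\<lambda>_. 1::real) = 0"
    using tangent_deriv_bounded_bilinear[OF assms open_UNIV UNIV_I smooth_into_const smooth_into_const
        bounded_bilinear_mult, of "1::real" 1] by simp
  then show ?thesis
    using tangent_deriv_bounded_linear[OF assms open_UNIV UNIV_I smooth_into_const
        bounded_linear_scaleR_left, of "1::real" a] by simp
qed

lemma tangent_deriv_sum:
  fixes F :: "'i \<Rightarrow> 'p \<Rightarrow> 'b::euclidean_space"
  assumes "v \<in> tangent_space A p" and W: "open W" "p \<in> W"
    and F: "\<And>i. i \<in> I \<Longrightarrow> smooth_into A W (F i)"
  shows "tangent_deriv v (\<lambda>q. \<Sum>i\<in>I. F i q) = (\<Sum>i\<in>I. tangent_deriv v (F i))"
  using F
proof (induction I rule: infinite_finite_induct)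
  case (insert i I)
  then show ?case
    using tangent_deriv_add[OF assms(1) W, of "F i" "\<lambda>q. \<Sum>i\<in>I. F i q"] smooth_into_sum[OF W(1), of I F]
    by simp
qed (simp_all add: tangent_deriv_const[OF assms(1)])

text \<open>A tangent vector is given in some chart around p; the chain rule moves it to any other
  such chart. Hence its coordinates in one fixed chart determine it. On functions not smooth near p
  both sides are 0.\<close>

lemma tangent_eq_chart_vector:
  assumes "v \<in> tangent_space A p" and U: "(U, c) \<in> A" "p \<in> U"
  shows "v = chart_vector U c p (tangent_deriv v c)"
proof
  fix f
  obtain V d w where V: "(V, d) \<in> A" "p \<in> V" and v: "v = chart_vector V d p w"
    using assms(1) unfolding tangent_space_iff by blast
  show "v f = chart_vector U c p (tangent_deriv v c) f"
  proof (cases "smooth_near A p f")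
    case True
    then obtain W where W: "open W" "p \<in> W" "smooth_into A W f" unfolding smooth_near_iff by blast
    let ?T = "frechet_derivative (c \<circ> inv_into V d) (at (d p))"
    let ?f' = "frechet_derivative (f \<circ> inv_into U c) (at (c p))"
    have T: "(c \<circ> inv_into V d has_derivative ?T) (at (d p))"
      using smooth_into_differentiable[OF smooth_into_chart[OF U(1)] U(2) V]
      unfolding frechet_derivative_works .
    have "(f \<circ> inv_into U c has_derivative ?f') (at (c p))"
      using smooth_into_differentiable[OF W(3,2) U] unfolding frechet_derivative_works .
    then have "(f \<circ> inv_into U c has_derivative ?f') (at ((c \<circ> inv_into V d) (d p)))"
      by (simp add: chart(4)[OF V])
    from diff_chain_at[OF T this]
    have "(f \<circ> inv_into U c \<circ> (c \<circ> inv_into V d) has_derivative ?f' \<circ> ?T) (at (d p))" .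
    \<comment> \<open>The composite through \<open>c\<close> equals
      \<open>f \<circ> inv_into V d\<close> only over the overlap of the two charts, whose image
      under \<open>d\<close> is open.\<close>
    then have "(f \<circ> inv_into V d has_derivative ?f' \<circ> ?T) (at (d p))"
      by (rule has_derivative_transform_within_open[OF _
            open_chart_image[OF V(1) chart(1)[OF U(1)]]])
        (use U V chart(4)[OF U(1)] chart(4)[OF V(1)] in auto)
    from frechet_derivative_at[OF this, symmetric]
    have "v f = ?f' (?T w)" using True unfolding v chart_vector_def by simp
    moreover have "tangent_deriv v c = ?T w"
      unfolding v
      by (rule tangent_deriv_chart_vector[OF V chart(1)[OF U(1)] U(2) smooth_into_chart[OF U(1)]])
    ultimately show ?thesis using True by (simp add: chart_vector_def)
  qed (simp add: tangent_not_smooth[OF assms(1)] chart_vector_def)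
qed

lemma vector_fieldD:
  assumes "X \<in> vector_fields A"
  shows "X p \<in> tangent_space A p"
    and "open W \<Longrightarrow> smooth_into A W f \<Longrightarrow> smooth_into A W (\<lambda>p. X p f)"
  using assms unfolding vector_fields_def smooth_fun_on_iff by blast+

end

section \<open>Connections on a manifold with a global frame\<close>

lemma linear_real_expand:
  fixes l :: "'a::euclidean_space \<Rightarrow> real"
  assumes "linear l"
  shows "l x = (\<Sum>b\<in>Basis. (x \<bullet> b) * l b)"
proof -
  have "l x = l (\<Sum>b\<in>Basis. (x \<bullet> b) *\<^sub>R b)" by (simp add: euclidean_representation)
  then show ?thesis by (simp add: linear_sum[OF assms] linear_scale[OF assms])
qed

lemma tangent_deriv_vf_add:
  "tangent_deriv (vf_add X Y p) F = tangent_deriv (X p) F + tangent_deriv (Y p) F"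
  by (simp add: tangent_deriv_def vf_add_def scaleR_add_left sum.distrib)

lemma tangent_deriv_vf_scale:
  "tangent_deriv (vf_scale h X p) F = h p *\<^sub>R tangent_deriv (X p) F"
  by (simp add: tangent_deriv_def vf_scale_def scaleR_sum_right)

text \<open>A parallelization indexed by the model space itself. No group appears here, only its
  consequence \<open>L_inj\<close>: independence of the fields at each single point.\<close>

locale frame = manifold A
  for A :: "('p::topological_space, 'a::euclidean_space) atlas" +
  fixes L :: "'a \<Rightarrow> 'p vfield"
  assumes L_field: "L x \<in> vector_fields A"
    and L_add: "L (x + y) = vf_add (L x) (L y)"
    and L_scale: "L (r *\<^sub>R x) = vf_scale (\<lambda>_. r) (L x)"
    and L_inj: "L x p = L y p \<Longrightarrow> x = y"
begin

abbreviation mc where "mc \<equiv> maurer_cartan L"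

lemma L_linear: "linear (\<lambda>x. L x p f)"
  by (rule linearI) (simp_all add: L_add L_scale vf_add_def vf_scale_def)

lemmas L_tangent = vector_fieldD(1)[OF L_field]

lemma L_coordinates_inj:
  assumes U: "(U, c) \<in> A" "p \<in> U" and eq: "tangent_deriv (L x p) c = tangent_deriv (L y p) c"
  shows "x = y"
proof (rule L_inj)
  have "L x p = chart_vector U c p (tangent_deriv (L x p) c)"
    by (rule tangent_eq_chart_vector[OF L_tangent U])
  also have "\<dots> = L y p"
    unfolding eq by (rule tangent_eq_chart_vector[OF L_tangent U, symmetric])
  finally show "L x p = L y p" .
qed

text \<open>By \<open>L_inj\<close> and dimension, the frame spans each tangent space.\<close>

lemma L_surj:
  assumes "v \<in> tangent_space A p"
  obtains x where "L x p = v"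
proof -
  obtain U c where U: "(U, c) \<in> A" "p \<in> U" by (rule chart_exists)
  let ?k = "\<lambda>x. tangent_deriv (L x p) c"
  have "linear ?k"
    by (rule linearI) (simp_all add: L_add L_scale tangent_deriv_vf_add tangent_deriv_vf_scale)
  moreover have "inj ?k"
    by (rule injI) (rule L_coordinates_inj[OF U])
  ultimately have "surj ?k" by (rule linear_injective_imp_surjective) simp
  then obtain x where x: "tangent_deriv v c = ?k x" by (rule surjE)
  have "L x p = chart_vector U c p (?k x)" by (rule tangent_eq_chart_vector[OF L_tangent U])
  also have "\<dots> = v" unfolding x[symmetric] by (rule tangent_eq_chart_vector[OF assms U, symmetric])
  finally show ?thesis by (rule that)
qed

lemma mc_eqI: "X p = L x p \<Longrightarrow> mc X p = x"
  unfolding maurer_cartan_def using L_inj by (metis inj_on_def inv_into_f_f UNIV_I)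

lemma mc_L: "mc (L x) p = x"
  by (rule mc_eqI) simp

lemma L_mc: "X \<in> vector_fields A \<Longrightarrow> L (mc X p) p = X p"
  using L_surj[OF vector_fieldD(1)] mc_eqI by metis

text \<open>In a chart, \<open>mc X\<close> solves the linear system whose columns are the
  coordinates of the frame fields and whose right-hand side is formed by the coordinates of X. Both
  are smooth, and \<open>L_coordinates_inj\<close> provides invertibility.\<close>

lemma mc_smooth:
  assumes X: "X \<in> vector_fields A"
  shows "smooth_into A UNIV (mc X)"
proof (rule smooth_intoI)
  fix U c k assume U: "(U, c) \<in> A"
  note i = chart(4)[OF U]
  have td: "smooth_on (c ` U) (\<lambda>y. tangent_deriv (Y (inv_into U c y)) c)" if "Y \<in> vector_fields A" for Y
  proof -
    have "smooth_into A U (\<lambda>p. tangent_deriv (Y p) c)"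
    proof (rule smooth_into_components[OF chart(1)[OF U]])
      fix b :: 'a assume "b \<in> Basis"
      then show "smooth_into A U (\<lambda>p. tangent_deriv (Y p) c \<bullet> b)"
        using vector_fieldD(2)[OF that chart(1)[OF U]
            smooth_into_inner[OF chart(1)[OF U] smooth_into_chart[OF U]]]
        by (simp add: tangent_deriv_inner)
    qed
    from smooth_intoD[OF this U] show ?thesis by (simp add: smooth_on_def)
  qed
  have M: "(\<Sum>b\<in>Basis. (x \<bullet> b) *\<^sub>R tangent_deriv (L b p) c) = tangent_deriv (L x p) c" for x p
  proof (rule euclidean_eqI)
    fix d :: 'a assume "d \<in> Basis"
    then show "(\<Sum>b\<in>Basis. (x \<bullet> b) *\<^sub>R tangent_deriv (L b p) c) \<bullet> d = tangent_deriv (L x p) c \<bullet> d"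
      using linear_real_expand[OF L_linear, of x p] by (simp add: inner_sum_left tangent_deriv_inner)
  qed
  have "smooth_on (c ` U) (\<lambda>y. mc X (inv_into U c y))"
  proof (rule linear_system_smooth_on[OF chart(2)[OF U] td[OF L_field] td[OF X]])
    show "inj (\<lambda>v. \<Sum>b\<in>Basis. (v \<bullet> b) *\<^sub>R tangent_deriv (L b (inv_into U c y)) c)"
      if "y \<in> c ` U" for y
    proof (rule injI)
      fix x x'
      have p: "inv_into U c y \<in> U" using that i by auto
      assume "(\<Sum>b\<in>Basis. (x \<bullet> b) *\<^sub>R tangent_deriv (L b (inv_into U c y)) c) =
        (\<Sum>b\<in>Basis. (x' \<bullet> b) *\<^sub>R tangent_deriv (L b (inv_into U c y)) c)"
      then show "x = x'"
        unfolding M by (rule L_coordinates_inj[OF U p])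
    qed
    show "(\<Sum>b\<in>Basis. (mc X (inv_into U c y) \<bullet> b) *\<^sub>R tangent_deriv (L b (inv_into U c y)) c) =
        tangent_deriv (X (inv_into U c y)) c" for y
      unfolding M L_mc[OF X] ..
  qed
  then show "Ck_on k (c ` (U \<inter> UNIV)) (\<lambda>y. mc X (inv_into U c y))" by (simp add: smooth_on_def)
qed

text \<open>Inverse to \<open>mc\<close>: the field whose components in the frame are prescribed by
  F.\<close>

definition field_of :: "('p \<Rightarrow> 'a) \<Rightarrow> 'p vfield" where
  "field_of F = (\<lambda>p. L (F p) p)"

lemma field_of_mc: "X \<in> vector_fields A \<Longrightarrow> field_of (mc X) = X"
  unfolding field_of_def by (rule ext) (rule L_mc)

lemma mc_field_of: "mc (field_of F) p = F p"
  by (rule mc_eqI) (simp add: field_of_def)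

lemma field_of_vector_field:
  assumes "smooth_into A UNIV F"
  shows "field_of F \<in> vector_fields A"
  unfolding vector_fields_def
proof (intro CollectI conjI allI impI)
  show "field_of F p \<in> tangent_space A p" for p unfolding field_of_def by (rule L_tangent)
  fix W f assume W: "open W" "smooth_fun_on A W f"
  have "smooth_into A W (\<lambda>p. \<Sum>b\<in>Basis. (F p \<bullet> b) * L b p f)"
    using W smooth_into_subset[OF assms subset_UNIV]
    by (intro smooth_into_sum smooth_into_bounded_bilinear[OF _ bounded_bilinear_mult]
        smooth_into_inner vector_fieldD(2)[OF L_field]) (simp_all add: smooth_fun_on_iff)
  then show "smooth_fun_on A W (\<lambda>p. field_of F p f)"
    unfolding smooth_fun_on_iff field_of_def linear_real_expand[OF L_linear, of "F _"] .
qed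

lemma mc_vf_add:
  assumes "X \<in> vector_fields A" and "Y \<in> vector_fields A"
  shows "mc (vf_add X Y) p = mc X p + mc Y p"
  using L_mc[OF assms(1), of p] L_mc[OF assms(2), of p] by (intro mc_eqI) (simp add: L_add vf_add_def)

lemma mc_vf_scale:
  assumes "X \<in> vector_fields A"
  shows "mc (vf_scale h X) p = h p *\<^sub>R mc X p"
  using L_mc[OF assms(1), of p] by (intro mc_eqI) (simp add: L_scale vf_scale_def)

lemma vf_add_eq:
  assumes "X \<in> vector_fields A" and "Y \<in> vector_fields A"
  shows "vf_add X Y = field_of (\<lambda>p. mc X p + mc Y p)"
  using L_mc[OF assms(1)] L_mc[OF assms(2)] by (simp add: field_of_def L_add vf_add_def)

lemma vf_scale_eq:
  assumes "X \<in> vector_fields A"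
  shows "vf_scale h X = field_of (\<lambda>p. h p *\<^sub>R mc X p)"
  using L_mc[OF assms(1)] by (simp add: field_of_def L_scale vf_scale_def)

lemma vf_add_vector_field:
  "X \<in> vector_fields A \<Longrightarrow> Y \<in> vector_fields A \<Longrightarrow> vf_add X Y \<in> vector_fields A"
  unfolding vf_add_eq by (intro field_of_vector_field smooth_into_add mc_smooth open_UNIV)

lemma vf_scale_vector_field:
  "smooth_into A UNIV h \<Longrightarrow> X \<in> vector_fields A \<Longrightarrow> vf_scale h X \<in> vector_fields A"
  unfolding vf_scale_eq
  by (intro field_of_vector_field smooth_into_bounded_bilinear[OF _ bounded_bilinear_scaleR]
      mc_smooth open_UNIV)

section \<open>Connections and their coefficients in the frame\<close>

lemma mc_deriv_smooth:
  assumes "X \<in> vector_fields A" and "Y \<in> vector_fields A"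
  shows "smooth_into A UNIV (\<lambda>p. tangent_deriv (X p) (mc Y))"
proof (rule smooth_into_components[OF open_UNIV])
  fix b :: 'a assume "b \<in> Basis"
  then show "smooth_into A UNIV (\<lambda>p. tangent_deriv (X p) (mc Y) \<bullet> b)"
    using vector_fieldD(2)[OF assms(1) open_UNIV smooth_into_inner[OF open_UNIV mc_smooth[OF assms(2)]]]
    by (simp add: tangent_deriv_inner)
qed

text \<open>The flat connection for which all fields \<open>L x\<close> are parallel, changed by a
  tensor with constant coefficients in the frame. The value \<open>undefined\<close> agrees with the
  convention in \<open>affine_connection\<close>.\<close>

definition frame_connection :: "('a \<Rightarrow> 'a \<Rightarrow> 'a) \<Rightarrow> 'p vfield \<Rightarrow> 'p vfield \<Rightarrow> 'p vfield" where
  "frame_connection \<Gamma> X Y =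
     (if X \<in> vector_fields A \<and> Y \<in> vector_fields A
      then field_of (\<lambda>p. tangent_deriv (X p) (mc Y) + \<Gamma> (mc X p) (mc Y p)) else undefined)"

lemma affine_frame_connection:
  assumes "bounded_bilinear \<Gamma>"
  shows "affine_connection A (frame_connection \<Gamma>)"
proof -
  interpret \<Gamma>: bounded_bilinear \<Gamma> by (rule assms)
  note td = tangent_deriv_vf_add tangent_deriv_vf_scale
  note vf = vf_add_vector_field vf_scale_vector_field
  note mc = mc_vf_add mc_vf_scale
  show ?thesis
    unfolding affine_connection_def
  proof (intro conjI allI impI ballI)
    show "frame_connection \<Gamma> X Y = undefined" if "\<not> (X \<in> vector_fields A \<and> Y \<in> vector_fields A)" for X Y
      unfolding frame_connection_def using that by (rule if_not_P)
  next
    fix X Y assume XY: "X \<in> vector_fields A" "Y \<in> vector_fields A"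
    then show "frame_connection \<Gamma> X Y \<in> vector_fields A"
      by (simp add: frame_connection_def field_of_vector_field smooth_into_add mc_deriv_smooth
          smooth_into_bounded_bilinear[OF _ assms] mc_smooth)
    fix X' assume X': "X' \<in> vector_fields A"
    show "frame_connection \<Gamma> (vf_add X X') Y =
        vf_add (frame_connection \<Gamma> X Y) (frame_connection \<Gamma> X' Y)"
      using XY X' by (simp add: frame_connection_def vf td mc \<Gamma>.add_left)
        (simp add: field_of_def vf_add_def L_add add_ac fun_eq_iff)
  next
    fix X Y Y' assume XY: "X \<in> vector_fields A" "Y \<in> vector_fields A" "Y' \<in> vector_fields A"
    have "mc (vf_add Y Y') = (\<lambda>q. mc Y q + mc Y' q)" using XY by (simp add: mc fun_eq_iff)
    then have "tangent_deriv (X p) (mc (vf_add Y Y')) =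
        tangent_deriv (X p) (mc Y) + tangent_deriv (X p) (mc Y')" for p
      using tangent_deriv_add[OF vector_fieldD(1)[OF XY(1)] open_UNIV UNIV_I
          mc_smooth[OF XY(2)] mc_smooth[OF XY(3)]] by simp
    then show "frame_connection \<Gamma> X (vf_add Y Y') =
        vf_add (frame_connection \<Gamma> X Y) (frame_connection \<Gamma> X Y')"
      using XY by (simp add: frame_connection_def vf mc \<Gamma>.add_right)
        (simp add: field_of_def vf_add_def L_add add_ac fun_eq_iff)
  next
    fix h X Y assume h: "smooth_fun_on A UNIV h" and XY: "X \<in> vector_fields A" "Y \<in> vector_fields A"
    have h': "smooth_into A UNIV h" using h by (simp add: smooth_fun_on_iff)
    show "frame_connection \<Gamma> (vf_scale h X) Y = vf_scale h (frame_connection \<Gamma> X Y)"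
      using XY h' by (simp add: frame_connection_def vf td mc \<Gamma>.scaleR_left)
        (simp add: field_of_def vf_scale_def L_scale scaleR_add_right[symmetric] fun_eq_iff)
    have "tangent_deriv (X p) (mc (vf_scale h Y)) =
        h p *\<^sub>R tangent_deriv (X p) (mc Y) + X p h *\<^sub>R mc Y p" for p
    proof -
      have "mc (vf_scale h Y) = (\<lambda>q. h q *\<^sub>R mc Y q)" using XY by (simp add: mc fun_eq_iff)
      then show ?thesis
        using tangent_deriv_bounded_bilinear[OF vector_fieldD(1)[OF XY(1)] open_UNIV UNIV_I h'
            mc_smooth[OF XY(2)] bounded_bilinear_scaleR]
        by (simp add: tangent_deriv_real)
    qed
    moreover have "Y p f = L (mc Y p) p f" for p f using L_mc[OF XY(2)] by simp
    ultimately show "frame_connection \<Gamma> X (vf_scale h Y) =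
        vf_add (vf_scale (\<lambda>p. X p h) Y) (vf_scale h (frame_connection \<Gamma> X Y))"
      using XY h' by (simp add: frame_connection_def vf mc \<Gamma>.scaleR_right)
        (simp add: field_of_def vf_scale_def vf_add_def L_scale L_add fun_eq_iff algebra_simps)
  qed
qed

text \<open>The Christoffel symbols in the frame. For a general connection they vary with the point
  \<open>p\<close>.\<close>

definition coeff :: "('p vfield \<Rightarrow> 'p vfield \<Rightarrow> 'p vfield) \<Rightarrow> 'p \<Rightarrow> 'a \<Rightarrow> 'a \<Rightarrow> 'a" where
  "coeff D p x y = mc (D (L x) (L y)) p"

lemma coeff_frame_connection: "coeff (frame_connection \<Gamma>) p = \<Gamma>"
proof (intro ext)
  fix x y
  have "mc (L y) = (\<lambda>_. y)" by (simp add: mc_L fun_eq_iff)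
  then show "coeff (frame_connection \<Gamma>) p x y = \<Gamma> x y"
    by (simp add: coeff_def frame_connection_def L_field mc_field_of mc_L
        tangent_deriv_const[OF L_tangent])
qed

lemma affine_connectionD:
  assumes "affine_connection A D"
  shows "X \<in> vector_fields A \<Longrightarrow> Y \<in> vector_fields A \<Longrightarrow> D X Y \<in> vector_fields A"
    and "X \<in> vector_fields A \<Longrightarrow> X' \<in> vector_fields A \<Longrightarrow> Y \<in> vector_fields A \<Longrightarrow>
      D (vf_add X X') Y = vf_add (D X Y) (D X' Y)"
    and "X \<in> vector_fields A \<Longrightarrow> Y \<in> vector_fields A \<Longrightarrow> Y' \<in> vector_fields A \<Longrightarrow>
      D X (vf_add Y Y') = vf_add (D X Y) (D X Y')"
    and "smooth_into A UNIV h \<Longrightarrow> X \<in> vector_fields A \<Longrightarrow> Y \<in> vector_fields A \<Longrightarrow>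
      D (vf_scale h X) Y = vf_scale h (D X Y)"
    and "smooth_into A UNIV h \<Longrightarrow> X \<in> vector_fields A \<Longrightarrow> Y \<in> vector_fields A \<Longrightarrow>
      D X (vf_scale h Y) = vf_add (vf_scale (\<lambda>p. X p h) Y) (vf_scale h (D X Y))"
    and "\<not> (X \<in> vector_fields A \<and> Y \<in> vector_fields A) \<Longrightarrow> D X Y = undefined"
  using assms unfolding affine_connection_def smooth_fun_on_iff by blast+

lemma coeff_bilinear:
  assumes D: "affine_connection A D"
  shows "bilinear (coeff D p)"
proof -
  note D = affine_connectionD[OF D]
  \<comment> \<open>Homogeneity in the second slot is the Leibniz rule with a constant factor, whose
    derivative vanishes.\<close>
  have "D (L x) (vf_scale (\<lambda>_. r) (L y)) = vf_scale (\<lambda>_. r) (D (L x) (L y))" for x y r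
    using D(5)[OF smooth_into_const[OF open_UNIV] L_field L_field]
      tangent_deriv_const[OF L_tangent, where a = "r::real"]
    by (simp add: vf_add_def vf_scale_def tangent_deriv_real)
  then show ?thesis
    unfolding bilinear_def coeff_def
    by (intro conjI allI linearI)
      (simp_all add: L_add L_scale D(2,3,4) smooth_into_const mc_vf_add mc_vf_scale L_field D(1))
qed

text \<open>Both fields are finite combinations of the fields \<open>L b\<close> with coefficients
  smooth on the whole manifold. Linearity over functions in the first slot and the Leibniz rule in
  the second therefore compute \<open>D X Y\<close> at p from the coefficients.\<close>

lemma connection_formula:
  assumes D: "affine_connection A D" and X: "X \<in> vector_fields A" and Y: "Y \<in> vector_fields A"
  shows "D X Y p = L (tangent_deriv (X p) (mc Y) + coeff D p (mc X p) (mc Y p)) p"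
proof
  fix f
  note D' = affine_connectionD[OF D]
  have sm: "smooth_into A UNIV (\<lambda>p. mc X p \<bullet> b)" if "X \<in> vector_fields A" for X b
    using mc_smooth[OF that] by (rule smooth_into_inner[OF open_UNIV])
  have Lb: "field_of (\<lambda>p. h p *\<^sub>R b) = vf_scale h (L b)" for h b
    unfolding field_of_def vf_scale_def by (simp add: L_scale vf_scale_def)
  \<comment> \<open>The axioms do not mention the zero field; written as 0 times a frame field, it
    is covered by the scaling rules. This settles the empty sums below.\<close>
  have zero: "field_of (\<lambda>_. 0) = vf_scale (\<lambda>_. 0) (L 0)"
    using Lb[of "\<lambda>_. 0" 0] by simp
  have add: "field_of (\<lambda>p. F p + G p) = vf_add (field_of F) (field_of G)" for F G
    unfolding field_of_def vf_add_def by (simp add: L_add vf_add_def)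
  have part: "field_of (\<lambda>p. \<Sum>b\<in>B. (mc X p \<bullet> b) *\<^sub>R b) \<in> vector_fields A"
    if "X \<in> vector_fields A" for X B
    using sm[OF that] by (intro field_of_vector_field smooth_into_sum[OF open_UNIV]
        smooth_into_bounded_linear[OF open_UNIV bounded_linear_scaleR_left])
  \<comment> \<open>Partial sums over \<open>B\<close> are needed because additivity of
    \<open>D\<close> is available only for two fields at a time.\<close>
  have 1: "D (field_of (\<lambda>p. \<Sum>b\<in>B. (mc X p \<bullet> b) *\<^sub>R b)) Z =
      (\<lambda>p f. \<Sum>b\<in>B. (mc X p \<bullet> b) * D (L b) Z p f)" if "finite B" "Z \<in> vector_fields A" for B Z
    using that(1)
  proof (induction B rule: finite_induct)
    case empty
    show ?case
      using D'(4)[where h = "\<lambda>_. 0", OF smooth_into_const[OF open_UNIV] L_field that(2), of 0]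
      by (simp add: zero vf_scale_def)
  next
    case (insert b B)
    then show ?case
      using D'(2)[OF vf_scale_vector_field[OF sm[OF X] L_field] part[OF X] that(2), of b b B]
        D'(4)[OF sm[OF X] L_field that(2), of b b]
      by (simp add: add Lb) (simp add: vf_add_def vf_scale_def)
  qed
  have 2: "D X (field_of (\<lambda>p. \<Sum>b\<in>B. (mc Y p \<bullet> b) *\<^sub>R b)) =
      (\<lambda>p f. \<Sum>b\<in>B. X p (\<lambda>q. mc Y q \<bullet> b) * L b p f + (mc Y p \<bullet> b) * D X (L b) p f)"
    if "finite B" for B
    using that
  proof (induction B rule: finite_induct)
    case empty
    have "X p (\<lambda>_. 0) = 0" for p
      using tangent_deriv_const[OF vector_fieldD(1)[OF X], where a = "0::real"] by (simp add: tangent_deriv_real)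
    then show ?case
      using D'(5)[where h = "\<lambda>_. 0", OF smooth_into_const[OF open_UNIV] X L_field, of 0]
      by (simp add: zero vf_scale_def vf_add_def)
  next
    case (insert b B)
    then show ?case
      using D'(3)[OF X vf_scale_vector_field[OF sm[OF Y] L_field] part[OF Y], of b b B]
        D'(5)[OF sm[OF Y] X L_field, of b b]
      by (simp add: add Lb) (simp add: vf_add_def vf_scale_def)
  qed
  have L1: "linear (\<lambda>x. L (coeff D p x y) p f)" for y
    using linear_compose[OF _ L_linear, of "\<lambda>x. coeff D p x y"] coeff_bilinear[OF D]
    by (simp add: bilinear_def o_def)
  have L2: "linear (\<lambda>y. L (coeff D p x y) p f)" for x
    using linear_compose[OF _ L_linear, of "\<lambda>y. coeff D p x y"] coeff_bilinear[OF D]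
    by (simp add: bilinear_def o_def)
  have DX: "D X (L b) p f = L (coeff D p (mc X p) b) p f" for b
    using 1[OF finite_Basis L_field] field_of_mc[OF X]
      linear_real_expand[OF L1, of "mc X p"] L_mc[OF D'(1)[OF L_field L_field]]
    by (simp add: euclidean_representation coeff_def)
  have "D X Y p f = (\<Sum>b\<in>Basis. X p (\<lambda>q. mc Y q \<bullet> b) * L b p f + (mc Y p \<bullet> b) * D X (L b) p f)"
    using 2[OF finite_Basis] field_of_mc[OF Y] by (simp add: euclidean_representation)
  also have "\<dots> = L (tangent_deriv (X p) (mc Y)) p f + L (coeff D p (mc X p) (mc Y p)) p f"
    unfolding DX sum.distrib linear_real_expand[OF L2, of _ "mc Y p"]
      linear_real_expand[OF L_linear, of "tangent_deriv _ _"]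
    by (simp add: tangent_deriv_inner)
  finally show "D X Y p f = L (tangent_deriv (X p) (mc Y) + coeff D p (mc X p) (mc Y p)) p f"
    by (simp add: linear_add[OF L_linear])
qed

lemma mc_connection:
  assumes "affine_connection A D" and "X \<in> vector_fields A" and "Y \<in> vector_fields A"
  shows "mc (D X Y) p = tangent_deriv (X p) (mc Y) + coeff D p (mc X p) (mc Y p)"
  by (rule mc_eqI) (rule connection_formula[OF assms])

text \<open>On vector fields the coefficients determine \<open>D\<close>; elsewhere both sides are
  \<open>undefined\<close>, so the equality holds between HOL functions.\<close>

lemma connection_eqI:
  assumes D: "affine_connection A D" and "\<And>p. coeff D p = \<Gamma>"
  shows "D = frame_connection \<Gamma>"
proof (intro ext)
  fix X Y p f
  show "D X Y p f = frame_connection \<Gamma> X Y p f"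
    using connection_formula[OF D, of X Y p] affine_connectionD(6)[OF D, of X Y] assms(2)
    by (simp add: frame_connection_def field_of_def)
qed

text \<open>In the frame g has constant coefficients. The product rule for
  \<open>g (mc Y q) (mc Z q)\<close> cancels all derivative terms and leaves an algebraic condition;
  on left invariant fields that condition is all that is said.\<close>

lemma metric_connection_iff:
  assumes "affine_connection A D" and g: "bounded_bilinear g"
  shows "metric_connection A L g D \<longleftrightarrow>
    (\<forall>p x y z. g (coeff D p x y) z + g y (coeff D p x z) = 0)"
proof
  assume m: "metric_connection A L g D"
  show "\<forall>p x y z. g (coeff D p x y) z + g y (coeff D p x z) = 0"
  proof (intro allI)
    fix p x y z
    have "L x p (li_form2 L g (L y) (L z)) =
        li_form2 L g (D (L x) (L y)) (L z) p + li_form2 L g (L y) (D (L x) (L z)) p"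
      using m L_field unfolding metric_connection_def by blast
    moreover have "li_form2 L g (L y) (L z) = (\<lambda>_. g y z)"
      by (simp add: li_form2_def mc_L fun_eq_iff)
    moreover have "L x p (\<lambda>_. g y z) = 0"
      using tangent_deriv_const[OF L_tangent, where a = "g y z"] by (simp add: tangent_deriv_real)
    ultimately show "g (coeff D p x y) z + g y (coeff D p x z) = 0"
      by (simp add: li_form2_def mc_L coeff_def)
  qed
next
  interpret g: bounded_bilinear g by (rule g)
  assume m: "\<forall>p x y z. g (coeff D p x y) z + g y (coeff D p x z) = 0"
  show "metric_connection A L g D"
    unfolding metric_connection_def
  proof (intro conjI ballI allI assms(1))
    fix X Y Z p
    assume X: "X \<in> vector_fields A" and Y: "Y \<in> vector_fields A" and Z: "Z \<in> vector_fields A"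
    have "li_form2 L g Y Z = (\<lambda>q. g (mc Y q) (mc Z q))" by (simp add: li_form2_def fun_eq_iff)
    then have "X p (li_form2 L g Y Z) =
        g (mc Y p) (tangent_deriv (X p) (mc Z)) + g (tangent_deriv (X p) (mc Y)) (mc Z p)"
      using tangent_deriv_bounded_bilinear[OF vector_fieldD(1)[OF X] open_UNIV UNIV_I
          mc_smooth[OF Y] mc_smooth[OF Z] g] by (simp add: tangent_deriv_real)
    then show "X p (li_form2 L g Y Z) = li_form2 L g (D X Y) Z p + li_form2 L g Y (D X Z) p"
      using m[rule_format, of p "mc X p" "mc Y p" "mc Z p"]
      by (simp add: li_form2_def mc_connection[OF assms(1) X] Y Z g.add_left g.add_right)
  qed
qed

text \<open>Being constant in the frame, \<phi> commutes with the derivative term of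
  \<open>mc_connection\<close>, so only the coefficient term can obstruct parallelism.\<close>

lemma parallel_endo_iff:
  assumes D: "affine_connection A D" and \<phi>: "linear \<phi>"
  shows "parallel_endo A L \<phi> D \<longleftrightarrow> (\<forall>p x y. coeff D p x (\<phi> y) = \<phi> (coeff D p x y))"
proof
  have li: "li_endo L \<phi> Y = field_of (\<lambda>p. \<phi> (mc Y p))" for Y
    by (simp add: li_endo_def field_of_def)
  {
    assume par: "parallel_endo A L \<phi> D"
    have "D (L x) (L (\<phi> y)) = field_of (\<lambda>p. \<phi> (coeff D p x y))" for x y
    proof -
      have "li_endo L \<phi> (L y) = L (\<phi> y)" unfolding li by (simp add: mc_L field_of_def)
      then show ?thesis
        using par L_field unfolding parallel_endo_def li[of "D _ _"] coeff_def by metis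
    qed
    then show "\<forall>p x y. coeff D p x (\<phi> y) = \<phi> (coeff D p x y)"
      by (simp add: coeff_def[of D _ _ "\<phi> _"] mc_field_of)
  next
    assume c: "\<forall>p x y. coeff D p x (\<phi> y) = \<phi> (coeff D p x y)"
    have b: "bounded_linear \<phi>" using \<phi> by (simp add: linear_conv_bounded_linear)
    show "parallel_endo A L \<phi> D"
      unfolding parallel_endo_def
    proof (intro ballI ext)
      fix X Y p f
      assume X: "X \<in> vector_fields A" and Y: "Y \<in> vector_fields A"
      have Y': "li_endo L \<phi> Y \<in> vector_fields A"
        unfolding li
        by (intro field_of_vector_field smooth_into_bounded_linear[OF open_UNIV b] mc_smooth Y)
      have "mc (li_endo L \<phi> Y) = (\<lambda>p. \<phi> (mc Y p))" by (simp add: li mc_field_of fun_eq_iff)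
      then have "D X (li_endo L \<phi> Y) p = L (\<phi> (mc (D X Y) p)) p"
        using c tangent_deriv_bounded_linear[OF vector_fieldD(1)[OF X] open_UNIV UNIV_I mc_smooth[OF Y] b]
        by (simp add: connection_formula[OF D X Y'] mc_connection[OF D X Y] linear_add[OF \<phi>])
      then show "D X (li_endo L \<phi> Y) p f = li_endo L \<phi> (D X Y) p f"
        by (simp add: li_endo_def)
    qed
  }
qed

end

section \<open>Bracket and torsion in the frame\<close>

locale lie_frame = frame A L
  for A :: "('p::topological_space, 'a::euclidean_space) atlas" and L :: "'a \<Rightarrow> 'p vfield" +
  fixes br :: "'a \<Rightarrow> 'a \<Rightarrow> 'a"
  assumes br: "bilinear br"
    and L_bracket: "L (br x y) = vf_bracket A (L x) (L y)"
begin

text \<open>The Maurer-Cartan equation for arbitrary fields. In X(Yf) - Y(Xf) the second derivatives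
  of f along the frame survive only through their antisymmetric part, which \<open>L_bracket\<close>
  turns into \<open>br\<close>.\<close>

lemma vf_bracket_eq:
  assumes X: "X \<in> vector_fields A" and Y: "Y \<in> vector_fields A"
  shows "vf_bracket A X Y p =
    L (tangent_deriv (X p) (mc Y) - tangent_deriv (Y p) (mc X) + br (mc X p) (mc Y p)) p"
proof
  fix f
  show "vf_bracket A X Y p f =
    L (tangent_deriv (X p) (mc Y) - tangent_deriv (Y p) (mc X) + br (mc X p) (mc Y p)) p f"
  proof (cases "smooth_near A p f")
    case True
    then obtain W where W: "open W" "p \<in> W" "smooth_into A W f" unfolding smooth_near_iff by blast
    \<comment> \<open>The iterated derivatives of f along the frame. This array is not symmetric:
      \<open>H c b - H b c\<close> is the derivative of f along \<open>L (br c b)\<close>.\<close>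
    define H where "H = (\<lambda>c b. L c p (\<lambda>q. L b q f))"
    have second: "X p (\<lambda>q. Y q f) = L (tangent_deriv (X p) (mc Y)) p f +
        (\<Sum>b\<in>Basis. \<Sum>c\<in>Basis. (mc X p \<bullet> c) * (mc Y p \<bullet> b) * H c b)"
      if X: "X \<in> vector_fields A" and Y: "Y \<in> vector_fields A" for X Y
    proof -
      have Lf: "smooth_into A W (\<lambda>q. L b q f)" for b by (rule vector_fieldD(2)[OF L_field W(1,3)])
      have Yb: "smooth_into A W (\<lambda>q. mc Y q \<bullet> b)" for b
        by (rule smooth_into_inner[OF W(1) smooth_into_subset[OF mc_smooth[OF Y] subset_UNIV]])
      have XL: "X p (\<lambda>q. L b q f) = (\<Sum>c\<in>Basis. (mc X p \<bullet> c) * H c b)" for b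
        using L_mc[OF X, of p] linear_real_expand[OF L_linear, of "mc X p" p "\<lambda>q. L b q f"]
        by (simp add: H_def)
      have "Y q f = (\<Sum>b\<in>Basis. (mc Y q \<bullet> b) * L b q f)" for q
        using L_mc[OF Y, of q] linear_real_expand[OF L_linear, of "mc Y q" q f] by simp
      then have "X p (\<lambda>q. Y q f) = tangent_deriv (X p) (\<lambda>q. \<Sum>b\<in>Basis. (mc Y q \<bullet> b) * L b q f)"
        by (simp add: tangent_deriv_real)
      also have "\<dots> = (\<Sum>b\<in>Basis. tangent_deriv (X p) (\<lambda>q. (mc Y q \<bullet> b) * L b q f))"
        by (rule tangent_deriv_sum[OF vector_fieldD(1)[OF X] W(1,2)])
          (rule smooth_into_bounded_bilinear[OF W(1) bounded_bilinear_mult Yb Lf])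
      also have "\<dots> = (\<Sum>b\<in>Basis. (mc Y p \<bullet> b) * X p (\<lambda>q. L b q f)) +
          (\<Sum>b\<in>Basis. X p (\<lambda>q. mc Y q \<bullet> b) * L b p f)"
        using tangent_deriv_bounded_bilinear[OF vector_fieldD(1)[OF X] W(1,2) Yb Lf
            bounded_bilinear_mult]
        by (simp add: tangent_deriv_real sum.distrib)
      also have "(\<Sum>b\<in>Basis. X p (\<lambda>q. mc Y q \<bullet> b) * L b p f) = L (tangent_deriv (X p) (mc Y)) p f"
        using linear_real_expand[OF L_linear, of "tangent_deriv (X p) (mc Y)" p f]
        by (simp add: tangent_deriv_inner)
      finally show ?thesis unfolding XL by (simp add: sum_distrib_left mult_ac)
    qed
    have Lbr: "L (br c b) p f = H c b - H b c" for c b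
      using True by (simp add: L_bracket vf_bracket_def H_def)
    have "L (br x y) p f = (\<Sum>b\<in>Basis. \<Sum>c\<in>Basis. (x \<bullet> c) * (y \<bullet> b) * L (br c b) p f)" for x y
    proof -
      have "linear (\<lambda>x. L (br x y) p f)" for y
        using linear_compose[OF _ L_linear, of "\<lambda>x. br x y"] br by (simp add: bilinear_def o_def)
      note 1 = linear_real_expand[OF this]
      have "linear (\<lambda>y. L (br x y) p f)" for x
        using linear_compose[OF _ L_linear, of "\<lambda>y. br x y"] br by (simp add: bilinear_def o_def)
      note 2 = linear_real_expand[OF this]
      show ?thesis
        unfolding 2[of x y] by (subst 1) (simp add: sum_distrib_left mult_ac)
    qed
    note expand = this[of "mc X p" "mc Y p"]
    \<comment> \<open>Renaming the summation indices shifts the exchange of X and Y onto the indices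
      of \<open>H\<close>.\<close>
    have "(\<Sum>b\<in>Basis. \<Sum>c\<in>Basis. (mc Y p \<bullet> c) * (mc X p \<bullet> b) * H c b) =
        (\<Sum>b\<in>Basis. \<Sum>c\<in>Basis. (mc X p \<bullet> c) * (mc Y p \<bullet> b) * H b c)"
      by (subst sum.swap) (simp add: mult_ac)
    then have "L (br (mc X p) (mc Y p)) p f =
        (\<Sum>b\<in>Basis. \<Sum>c\<in>Basis. (mc X p \<bullet> c) * (mc Y p \<bullet> b) * H c b) -
        (\<Sum>b\<in>Basis. \<Sum>c\<in>Basis. (mc Y p \<bullet> c) * (mc X p \<bullet> b) * H c b)"
      unfolding expand unfolding Lbr by (simp add: right_diff_distrib sum_subtractf)
    then show ?thesis
      using True second[OF X Y] second[OF Y X]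
      by (simp add: vf_bracket_def linear_add[OF L_linear] linear_diff[OF L_linear])
  qed (simp add: vf_bracket_def tangent_not_smooth[OF L_tangent])
qed

text \<open>The derivative terms of \<open>D X Y - D Y X\<close> are those of the bracket and
  cancel, leaving an expression in the values at p.\<close>

lemma torsion_form_eq:
  assumes D: "affine_connection A D" and X: "X \<in> vector_fields A" and Y: "Y \<in> vector_fields A"
  shows "torsion_form A L g D X Y Z p =
    g (coeff D p (mc X p) (mc Y p) - coeff D p (mc Y p) (mc X p) - br (mc X p) (mc Y p)) (mc Z p)"
proof -
  have "mc (torsion A D X Y) p =
      coeff D p (mc X p) (mc Y p) - coeff D p (mc Y p) (mc X p) - br (mc X p) (mc Y p)"
    by (rule mc_eqI) (simp add: torsion_def vf_diff_def connection_formula[OF D] X Y vf_bracket_eq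
        linear_add[OF L_linear] linear_diff[OF L_linear] fun_eq_iff)
  then show ?thesis by (simp add: torsion_form_def li_form2_def)
qed

lemma has_torsion_form_iff:
  assumes D: "affine_connection A D"
  shows "has_torsion_form A L g T D \<longleftrightarrow>
    (\<forall>p x y z. g (coeff D p x y - coeff D p y x - br x y) z = T x y z)"
proof
  assume h: "has_torsion_form A L g T D"
  show "\<forall>p x y z. g (coeff D p x y - coeff D p y x - br x y) z = T x y z"
  proof (intro allI)
    fix p x y z
    have "torsion_form A L g D (L x) (L y) (L z) p = li_form3 L T (L x) (L y) (L z) p"
      using h L_field unfolding has_torsion_form_def by blast
    then show "g (coeff D p x y - coeff D p y x - br x y) z = T x y z"
      by (simp add: torsion_form_eq[OF D] L_field li_form3_def mc_L)
  qed
qed (simp add: has_torsion_form_def torsion_form_eq[OF D] li_form3_def)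

lemma skew_torsion_iff:
  assumes D: "affine_connection A D"
  shows "skew_torsion A L g D \<longleftrightarrow>
    (\<forall>p x y z. g (coeff D p x y - coeff D p y x - br x y) z =
        - g (coeff D p y x - coeff D p x y - br y x) z \<and>
      g (coeff D p x y - coeff D p y x - br x y) z =
        - g (coeff D p x z - coeff D p z x - br x z) y)"
proof
  assume h: "skew_torsion A L g D"
  show "\<forall>p x y z. g (coeff D p x y - coeff D p y x - br x y) z =
        - g (coeff D p y x - coeff D p x y - br y x) z \<and>
      g (coeff D p x y - coeff D p y x - br x y) z =
        - g (coeff D p x z - coeff D p z x - br x z) y"
  proof (intro allI)
    fix p x y z
    have "torsion_form A L g D (L x) (L y) (L z) p = - torsion_form A L g D (L y) (L x) (L z) p \<and>
      torsion_form A L g D (L x) (L y) (L z) p = - torsion_form A L g D (L x) (L z) (L y) p"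
      using h L_field unfolding skew_torsion_def by blast
    then show "g (coeff D p x y - coeff D p y x - br x y) z =
        - g (coeff D p y x - coeff D p x y - br y x) z \<and>
      g (coeff D p x y - coeff D p y x - br x y) z =
        - g (coeff D p x z - coeff D p z x - br x z) y"
      by (simp add: torsion_form_eq[OF D] L_field mc_L)
  qed
next
  assume h: "\<forall>p x y z. g (coeff D p x y - coeff D p y x - br x y) z =
        - g (coeff D p y x - coeff D p x y - br y x) z \<and>
      g (coeff D p x y - coeff D p y x - br x y) z =
        - g (coeff D p x z - coeff D p z x - br x z) y"
  show "skew_torsion A L g D"
    unfolding skew_torsion_def
  proof (intro ballI allI)
    fix X Y Z p
    assume "X \<in> vector_fields A" "Y \<in> vector_fields A" "Z \<in> vector_fields A"
    note t = torsion_form_eq[OF D this(1,2)] torsion_form_eq[OF D this(2,1)]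
      torsion_form_eq[OF D this(1,3)]
    show "torsion_form A L g D X Y Z p = - torsion_form A L g D Y X Z p \<and>
        torsion_form A L g D X Y Z p = - torsion_form A L g D X Z Y p"
      unfolding t by (rule h[rule_format])
  qed
qed

end

section \<open>The left invariant frame of a Lie group\<close>

lemma lie_group_frame:
  assumes "lie_group G A" and "lie_algebra_of_group G A br L" and "bilinear br"
  shows "lie_frame A L br"
proof -
  interpret group G using assms(1) unfolding lie_group_def by blast
  have UN: "carrier G = UNIV" using assms(1) unfolding lie_group_def by blast
  note L = assms(2)[unfolded lie_algebra_of_group_def]
  have bij: "bij_betw L UNIV (left_invariant_fields G A)" using L by blast
  then have li: "L x \<in> left_invariant_fields G A" for x by (auto simp: bij_betw_def)
  have inj: "x = y" if eq: "L x p = L y p" for x y p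
  proof -
    have "L x q f = L y q f" for q f
    proof -
      have q: "q = (q \<otimes>\<^bsub>G\<^esub> inv\<^bsub>G\<^esub> p) \<otimes>\<^bsub>G\<^esub> p" using UN by (simp add: m_assoc)
      have "L z q f = L z p (\<lambda>r. f ((q \<otimes>\<^bsub>G\<^esub> inv\<^bsub>G\<^esub> p) \<otimes>\<^bsub>G\<^esub> r))" for z
        using li[of z] unfolding left_invariant_fields_def by (subst q) blast
      then show ?thesis using eq by simp
    qed
    then have "L x = L y" by blast
    then show ?thesis using bij by (auto simp: bij_betw_def dest: injD)
  qed
  show ?thesis
  proof unfold_locales
    show "smooth_atlas A" using assms(1) unfolding lie_group_def by blast
    show "L x \<in> vector_fields A" for x using li unfolding left_invariant_fields_def by blast
    show "L (x + y) = vf_add (L x) (L y)" "L (r *\<^sub>R x) = vf_scale (\<lambda>_. r) (L x)"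
      "L (br x y) = vf_bracket A (L x) (L y)" for x y r using L by simp_all
    show "L x p = L y p \<Longrightarrow> x = y" for x y p by (rule inj)
    show "bilinear br" by (rule assms(3))
  qed
qed

section \<open>The algebra of a parallel canonical structure\<close>

locale inner_product =
  fixes g :: "'a::euclidean_space \<Rightarrow> 'a \<Rightarrow> real"
  assumes ip: "inner_product_on_space g"
begin

lemma g_sym: "g x y = g y x"
  and g_linear_right: "linear (g x)"
  using ip unfolding inner_product_on_space_def by blast+

lemma g_linear_left: "linear (\<lambda>x. g x y)"
proof -
  have "(\<lambda>x. g x y) = g y" by (rule ext) (rule g_sym)
  then show ?thesis by (simp only: g_linear_right)
qed

lemmas g_simps = linear_add[OF g_linear_left] linear_add[OF g_linear_right]
  linear_diff[OF g_linear_left] linear_diff[OF g_linear_right]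
  linear_neg[OF g_linear_left] linear_neg[OF g_linear_right]
  linear_scale[OF g_linear_left] linear_scale[OF g_linear_right]
  linear_0[OF g_linear_left] linear_0[OF g_linear_right]

lemma g_bilinear: "bounded_bilinear g"
  using g_linear_left g_linear_right
  by (simp add: bilinear_conv_bounded_bilinear[symmetric] bilinear_def)

lemma g_eqI:
  assumes "\<And>z. g x z = g y z"
  shows "x = y"
proof (rule ccontr)
  assume "x \<noteq> y"
  then have "0 < g (x - y) (x - y)" using ip unfolding inner_product_on_space_def by simp
  then show False using assms by (simp add: g_simps)
qed

text \<open>\<open>Basis\<close> is orthonormal for the inner product of the type class, not for g.
  So w is not written down: the values of \<open>g w\<close> on \<open>Basis\<close> depend
  injectively on w because g is definite, hence surjectively by dimension.\<close>

lemma riesz: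
  assumes f: "linear f"
  obtains w where "\<And>z. g w z = f z"
proof -
  let ?k = "\<lambda>w. \<Sum>b\<in>Basis. g w b *\<^sub>R b"
  have comp: "(\<Sum>b\<in>Basis. h b *\<^sub>R b) \<bullet> d = h d" if "d \<in> Basis" for h :: "'a \<Rightarrow> real" and d
    using that by (simp add: inner_sum_left inner_Basis if_distrib cong: if_cong)
  have "linear ?k"
    by (rule linearI) (simp_all add: g_simps scaleR_add_left sum.distrib scaleR_sum_right)
  moreover have "inj ?k"
  proof (rule injI, rule g_eqI)
    fix x y z assume eq: "?k x = ?k y"
    have "g x d = g y d" if "d \<in> Basis" for d
      using arg_cong[OF eq, of "\<lambda>v. v \<bullet> d"] unfolding comp[OF that] .
    then show "g x z = g y z"
      unfolding linear_real_expand[OF g_linear_right, of x z] linear_real_expand[OF g_linear_right, of y z] by simp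
  qed
  ultimately have "surj ?k" by (rule linear_injective_imp_surjective) simp
  then obtain w where eq: "(\<Sum>b\<in>Basis. f b *\<^sub>R b) = ?k w" by (rule surjE)
  have "g w d = f d" if "d \<in> Basis" for d
    using arg_cong[OF eq, of "\<lambda>v. v \<bullet> d"] unfolding comp[OF that] by (rule sym)
  then have "g w z = f z" for z
    unfolding linear_real_expand[OF g_linear_right, of w z] linear_real_expand[OF f, of z] by simp
  then show ?thesis by (rule that)
qed

end

lemma lie_algebraD:
  assumes "lie_algebra br"
  shows "linear (br x)" "linear (\<lambda>x. br x y)" "br x x = 0"
    "br x (br y z) + br y (br z x) + br z (br x y) = 0"
  using assms unfolding lie_algebra_def by blast+

locale parallel_canonical_algebra =
  fixes br :: "'a::euclidean_space \<Rightarrow> 'a \<Rightarrow> 'a" and \<phi> \<xi> \<eta> g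
  assumes str: "almost_3_contact_metric_lie_algebra br \<phi> \<xi> \<eta> g"
    and pc: "parallel_canonical br \<phi> \<xi> \<eta>"
    and delta: "delta_const br \<xi> \<eta> \<noteq> 0"
begin

abbreviation \<delta> where "\<delta> \<equiv> delta_const br \<xi> \<eta>"
abbreviation H where "H \<equiv> hor_part \<xi> \<eta>"
abbreviation h where "h \<equiv> horizontal \<eta>"

sublocale inner_product g
  using str unfolding almost_3_contact_metric_lie_algebra_def by unfold_locales blast

lemma lie: "lie_algebra br"
  using str unfolding almost_3_contact_metric_lie_algebra_def by blast

lemmas br_linear = lie_algebraD(2,1)[OF lie]
lemmas br_simps = linear_add[OF br_linear(1)] linear_add[OF br_linear(2)]
  linear_diff[OF br_linear(1)] linear_diff[OF br_linear(2)]
  linear_neg[OF br_linear(1)] linear_neg[OF br_linear(2)]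
  linear_scale[OF br_linear(1)] linear_scale[OF br_linear(2)]
  linear_0[OF br_linear(1)] linear_0[OF br_linear(2)] lie_algebraD(3)[OF lie]

lemma br_bilinear: "bilinear br"
  using br_linear by (simp add: bilinear_def)

lemma br_swap: "br x y = - br y x"
proof -
  have "br (x + y) (x + y) = (br x x + br y x) + (br x y + br y y)"
    by (simp only: linear_add[OF br_linear(1)] linear_add[OF br_linear(2)])
  then show ?thesis by (simp add: lie_algebraD(3)[OF lie] eq_neg_iff_add_eq_0 add.commute)
qed

lemma abelian: "abelian_3_contact br \<phi> \<xi> \<eta>"
  using pc unfolding parallel_canonical_def by blast

lemma contact:
  assumes "i \<in> {1,2,3}"
  shows "linear (\<phi> i)" "linear (\<eta> i)" "\<phi> i (\<phi> i X) = - X + \<eta> i X *\<^sub>R \<xi> i" "\<eta> i (\<xi> i) = 1"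
    "g (\<phi> i X) (\<phi> i Y) = g X Y - \<eta> i X * \<eta> i Y"
    "\<eta> i X = 0 \<Longrightarrow> \<eta> i Y = 0 \<Longrightarrow> br (\<phi> i X) (\<phi> i Y) = br X Y"
proof -
  have "almost_contact (\<phi> i) (\<xi> i) (\<eta> i)"
    using str assms unfolding almost_3_contact_metric_lie_algebra_def by blast
  then show "linear (\<phi> i)" "linear (\<eta> i)" "\<phi> i (\<phi> i X) = - X + \<eta> i X *\<^sub>R \<xi> i" "\<eta> i (\<xi> i) = 1"
    unfolding almost_contact_def by blast+
  show "g (\<phi> i X) (\<phi> i Y) = g X Y - \<eta> i X * \<eta> i Y"
    using str assms unfolding almost_3_contact_metric_lie_algebra_def by blast
  show "\<eta> i X = 0 \<Longrightarrow> \<eta> i Y = 0 \<Longrightarrow> br (\<phi> i X) (\<phi> i Y) = br X Y"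
    using abelian assms unfolding abelian_3_contact_def abelian_almost_contact_def by blast
qed

lemmas phi_simps = contact(1)[THEN linear_add] contact(1)[THEN linear_diff]
  contact(1)[THEN linear_neg] contact(1)[THEN linear_scale] contact(1)[THEN linear_0]
lemmas eta_simps = contact(2)[THEN linear_add] contact(2)[THEN linear_diff]
  contact(2)[THEN linear_neg] contact(2)[THEN linear_scale] contact(2)[THEN linear_0]

text \<open>Evaluating the cube of \<open>\<phi> i\<close> in two ways shows that
  \<open>\<phi> i (\<xi> i)\<close> is a multiple of \<open>\<xi> i\<close>. As
  \<open>\<phi> i\<close> applied twice kills \<open>\<xi> i\<close>, the multiple is 0.\<close>

lemma phi_xi:
  assumes i: "i \<in> {1,2,3}"
  shows "\<phi> i (\<xi> i) = 0" "\<eta> i (\<phi> i X) = 0"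
proof -
  have "\<xi> i \<noteq> 0" using contact(4)[OF i] eta_simps(5)[OF i] by fastforce
  have a: "\<eta> i (\<phi> i y) *\<^sub>R \<xi> i = \<eta> i y *\<^sub>R \<phi> i (\<xi> i)" for y
    using contact(3)[OF i, of "\<phi> i y"] arg_cong[OF contact(3)[OF i, of y], of "\<phi> i"]
    by (simp add: phi_simps[OF i])
  have b: "\<eta> i (\<phi> i (\<xi> i)) *\<^sub>R \<xi> i = \<phi> i (\<xi> i)" using a[of "\<xi> i"] contact(4)[OF i] by simp
  have "\<phi> i (\<phi> i (\<xi> i)) = 0" using contact(3,4)[OF i] by simp
  then have "\<eta> i (\<phi> i (\<xi> i)) *\<^sub>R \<phi> i (\<xi> i) = 0" using b phi_simps(4)[OF i] by metis
  then show "\<phi> i (\<xi> i) = 0" using b by force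
  then show "\<eta> i (\<phi> i X) = 0" using a[of X] \<open>\<xi> i \<noteq> 0\<close> by simp
qed

text \<open>Facts stated for a triple \<open>(i, j, k)\<close> are reused for the other two even
  permutations by rotating it.\<close>

lemma even_perms3_rotate: "(i, j, k) \<in> even_perms3 \<Longrightarrow> (j, k, i) \<in> even_perms3"
  and even_perms3_index:
    "(i, j, k) \<in> even_perms3 \<Longrightarrow> i \<in> {1,2,3} \<and> j \<in> {1,2,3} \<and> k \<in> {1,2,3} \<and> {1,2,3} = {i, j, k}"
  and even_perms3_distinct: "(i, j, k) \<in> even_perms3 \<Longrightarrow> i \<noteq> j \<and> j \<noteq> k \<and> i \<noteq> k"
  by (auto simp: even_perms3_def)

lemma even_perms3_exists: "i \<in> {1,2,3} \<Longrightarrow> \<exists>j k. (i, j, k) \<in> even_perms3"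
  by (auto simp: even_perms3_def)

lemma quaternionic:
  assumes "(i, j, k) \<in> even_perms3"
  shows "\<phi> k X = \<phi> i (\<phi> j X) - \<eta> j X *\<^sub>R \<xi> i" "\<phi> k X = - \<phi> j (\<phi> i X) + \<eta> i X *\<^sub>R \<xi> j"
    "\<phi> i (\<xi> j) = \<xi> k" "\<phi> j (\<xi> i) = - \<xi> k" "\<eta> i (\<phi> j X) = \<eta> k X" "\<eta> j (\<phi> i X) = - \<eta> k X"
proof -
  have *: "(\<forall>X. \<phi> k X = \<phi> i (\<phi> j X) - \<eta> j X *\<^sub>R \<xi> i \<and>
      \<phi> k X = - \<phi> j (\<phi> i X) + \<eta> i X *\<^sub>R \<xi> j) \<and>
    \<xi> k = \<phi> i (\<xi> j) \<and> \<xi> k = - \<phi> j (\<xi> i) \<and>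
    (\<forall>X. \<eta> k X = \<eta> i (\<phi> j X) \<and> \<eta> k X = - \<eta> j (\<phi> i X))"
    using str assms unfolding almost_3_contact_metric_lie_algebra_def by fast
  show "\<phi> k X = \<phi> i (\<phi> j X) - \<eta> j X *\<^sub>R \<xi> i" "\<phi> k X = - \<phi> j (\<phi> i X) + \<eta> i X *\<^sub>R \<xi> j"
    using * by blast+
  show "\<phi> i (\<xi> j) = \<xi> k" "\<phi> j (\<xi> i) = - \<xi> k" "\<eta> i (\<phi> j X) = \<eta> k X" "\<eta> j (\<phi> i X) = - \<eta> k X"
    using * by (metis minus_minus)+
qed

lemma frame:
  assumes "(i, j, k) \<in> even_perms3"
  shows "\<eta> i (\<xi> i) = 1" "\<eta> j (\<xi> i) = 0" "\<eta> k (\<xi> i) = 0"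
    "\<phi> i (\<xi> i) = 0" "\<phi> i (\<xi> j) = \<xi> k" "\<phi> i (\<xi> k) = - \<xi> j"
    "\<eta> i (\<phi> i X) = 0" "\<eta> j (\<phi> i X) = - \<eta> k X" "\<eta> k (\<phi> i X) = \<eta> j X"
proof -
  note r = even_perms3_rotate[OF assms]
  note r2 = even_perms3_rotate[OF r]
  have i: "i \<in> {1,2,3}" using even_perms3_index[OF assms] by blast
  show *: "\<eta> i (\<xi> i) = 1" "\<phi> i (\<xi> i) = 0" "\<eta> i (\<phi> i X) = 0" "\<phi> i (\<xi> j) = \<xi> k"
    "\<phi> i (\<xi> k) = - \<xi> j" "\<eta> j (\<phi> i X) = - \<eta> k X" "\<eta> k (\<phi> i X) = \<eta> j X" for X
    using contact(4)[OF i] phi_xi[OF i] quaternionic(3,6)[OF assms] quaternionic(4,5)[OF r2] by auto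
  \<comment> \<open>Duality between different indices comes from inserting
    \<open>\<phi> i (\<xi> i) = 0\<close> into the formulas for \<open>\<eta> j\<close> and
    \<open>\<eta> k\<close> after \<open>\<phi> i\<close>.\<close>
  have "\<eta> j 0 = 0" "\<eta> k 0 = 0" using eta_simps(5) even_perms3_index[OF assms] by blast+
  then show "\<eta> j (\<xi> i) = 0" "\<eta> k (\<xi> i) = 0" using *(6,7)[of "\<xi> i"] *(2) by auto
qed

section \<open>The splitting into horizontal and vertical parts\<close>

lemma hor_part_eq:
  assumes "(i, j, k) \<in> even_perms3"
  shows "H X = X - \<eta> i X *\<^sub>R \<xi> i - \<eta> j X *\<^sub>R \<xi> j - \<eta> k X *\<^sub>R \<xi> k"
proof -
  have "{1,2,3} = {i, j, k}" using even_perms3_index[OF assms] by blast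
  then show ?thesis
    using even_perms3_distinct[OF assms] by (simp add: hor_part_def algebra_simps del: One_nat_def)
qed

lemma horizontalD: "X \<in> h \<Longrightarrow> i \<in> {1,2,3} \<Longrightarrow> \<eta> i X = 0"
  unfolding horizontal_def by blast

lemma hor_part_horizontal: "H X \<in> h"
proof -
  have "\<eta> i (H X) = 0" if i: "i \<in> {1,2,3}" for i
  proof -
    obtain j k where p: "(i, j, k) \<in> even_perms3" using even_perms3_exists[OF i] by blast
    note r = even_perms3_rotate[OF p]
    note r2 = even_perms3_rotate[OF r]
    show ?thesis
      unfolding hor_part_eq[OF p] using frame[OF p] frame[OF r] frame[OF r2]
      by (simp add: eta_simps[OF i])
  qed
  then show ?thesis unfolding horizontal_def by blast
qed

lemma hor_part_id: "X \<in> h \<Longrightarrow> H X = X"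
  unfolding hor_part_def by (simp add: horizontalD del: One_nat_def)

lemma hor_part_linear: "linear H"
proof -
  have p: "(1, 2, 3) \<in> even_perms3" by (simp add: even_perms3_def)
  have i: "1 \<in> {1,2,3::nat}" "2 \<in> {1,2,3::nat}" "3 \<in> {1,2,3::nat}" by auto
  show ?thesis
    by (rule linearI; unfold hor_part_eq[OF p])
      (simp_all add: eta_simps[OF i(1)] eta_simps[OF i(2)] eta_simps[OF i(3)] algebra_simps
        del: One_nat_def)
qed

lemma hor_part_xi:
  assumes i: "i \<in> {1,2,3}"
  shows "H (\<xi> i) = 0"
proof -
  obtain j k where p: "(i, j, k) \<in> even_perms3" using even_perms3_exists[OF i] by blast
  show ?thesis unfolding hor_part_eq[OF p] using frame[OF p] by simp
qed

lemma hor_part_phi: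
  assumes i: "i \<in> {1,2,3}"
  shows "H (\<phi> i X) = \<phi> i (H X)"
proof -
  obtain j k where p: "(i, j, k) \<in> even_perms3" using even_perms3_exists[OF i] by blast
  show ?thesis
    unfolding hor_part_eq[OF p] using frame[OF p] by (simp add: phi_simps[OF i])
qed

lemma phi_horizontal: "i \<in> {1,2,3} \<Longrightarrow> X \<in> h \<Longrightarrow> \<phi> i X \<in> h"
  using hor_part_phi[of i X] hor_part_horizontal[of "\<phi> i X"] by (simp add: hor_part_id)

lemma phi_phi_horizontal: "i \<in> {1,2,3} \<Longrightarrow> X \<in> h \<Longrightarrow> \<phi> i (\<phi> i X) = - X"
  by (simp add: contact(3) horizontalD)

text \<open>The vanishing of Z puts the bracket into the kernel of \<open>\<phi> i\<close>. Applying
  \<open>\<phi> i\<close> once more shows that a vector in this kernel equals its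
  \<open>\<eta> i\<close>-component times \<open>\<xi> i\<close>.\<close>

lemma br_xi_xi:
  assumes p: "(i, j, k) \<in> even_perms3"
  shows "br (\<xi> j) (\<xi> k) = (2 * \<delta>) *\<^sub>R \<xi> i"
proof -
  have i: "i \<in> {1,2,3}" using even_perms3_index[OF p] by blast
  have "\<phi> i (br (\<xi> j) (\<xi> k)) = 0"
    using Z_vec_eq[OF str abelian p] pc unfolding parallel_canonical_def by simp
  then show ?thesis
    using contact(3)[OF i, of "br (\<xi> j) (\<xi> k)"] delta_const_eq[OF str abelian p]
    by (simp add: phi_simps[OF i])
qed

text \<open>\<psi> evaluated at \<open>\<phi> i X\<close> is the bracket of \<open>\<xi> i\<close>
  with \<open>\<phi> i (\<phi> i X) = - X\<close>.\<close>

lemma br_xi_horizontal: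
  assumes i: "i \<in> {1,2,3}" and X: "X \<in> h"
  shows "br (\<xi> i) X = 0"
proof -
  have "br (\<xi> i) (\<phi> i (\<phi> i X)) = 0"
    using psi_map_eq(1)[OF str abelian i phi_horizontal[OF i X]] phi_horizontal[OF i X] pc
    unfolding parallel_canonical_def by simp
  then show ?thesis by (simp add: phi_phi_horizontal[OF i X] br_simps)
qed

lemma br_xi:
  assumes p: "(i, j, k) \<in> even_perms3"
  shows "br (\<xi> i) X = (2 * \<delta>) *\<^sub>R (\<eta> j X *\<^sub>R \<xi> k - \<eta> k X *\<^sub>R \<xi> j)"
proof -
  note r = even_perms3_rotate[OF p]
  note r2 = even_perms3_rotate[OF r]
  have i: "i \<in> {1,2,3}" using even_perms3_index[OF p] by blast
  have "br (\<xi> i) (\<xi> k) = - ((2 * \<delta>) *\<^sub>R \<xi> j)" using br_swap[of "\<xi> i"] br_xi_xi[OF r] by simp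
  then show ?thesis
    using br_xi_horizontal[OF i hor_part_horizontal[of X]] br_xi_xi[OF r2]
    unfolding hor_part_eq[OF p] by (simp add: br_simps algebra_simps)
qed

text \<open>
  By the Jacobi identity \<open>ad \<xi>\<^sub>i\<close> kills \<open>[X, Y]\<close>, and \<open>\<delta> \<noteq> 0\<close> makes the joint kernel of the
  \<open>ad \<xi>\<^sub>i\<close> horizontal.
\<close>

lemma br_horizontal:
  assumes X: "X \<in> h" and Y: "Y \<in> h"
  shows "br X Y \<in> h"
proof -
  have "\<eta> k (br X Y) = 0" if k: "k \<in> {1,2,3}" for k
  proof -
    obtain i j where "(k, i, j) \<in> even_perms3" using even_perms3_exists[OF k] by blast
    then have p: "(i, j, k) \<in> even_perms3" by (rule even_perms3_rotate)
    have i: "i \<in> {1,2,3}" using even_perms3_index[OF p] by blast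
    have "br (\<xi> i) (br X Y) = 0"
      using lie_algebraD(4)[OF lie, of "\<xi> i" X Y] br_xi_horizontal[OF i X] br_xi_horizontal[OF i Y]
        br_swap[of Y "\<xi> i"] by (simp add: br_simps)
    then have "\<eta> j (br X Y) *\<^sub>R \<xi> k - \<eta> k (br X Y) *\<^sub>R \<xi> j = 0"
      using delta by (simp add: br_xi[OF p])
    then have "\<eta> j (\<eta> j (br X Y) *\<^sub>R \<xi> k - \<eta> k (br X Y) *\<^sub>R \<xi> j) = \<eta> j 0" by (rule arg_cong)
    moreover have j: "j \<in> {1,2,3}" using even_perms3_index[OF p] by blast
    ultimately show ?thesis
      using frame[OF even_perms3_rotate[OF p]] frame[OF even_perms3_rotate[OF even_perms3_rotate[OF p]]]
      by (simp add: eta_simps[OF j])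
  qed
  then show ?thesis unfolding horizontal_def by blast
qed

text \<open>The second summand is 2\<delta> times the cross product of the vertical coordinates. It
  underlies the direct product, the isomorphism with so(3) and the term \<open>wedge3\<close> of the
  torsion.\<close>

lemma br_decompose:
  assumes p: "(i, j, k) \<in> even_perms3"
  shows "br X Y = br (H X) (H Y) + (2 * \<delta>) *\<^sub>R
    ((\<eta> j X * \<eta> k Y - \<eta> k X * \<eta> j Y) *\<^sub>R \<xi> i + (\<eta> k X * \<eta> i Y - \<eta> i X * \<eta> k Y) *\<^sub>R \<xi> j +
     (\<eta> i X * \<eta> j Y - \<eta> j X * \<eta> i Y) *\<^sub>R \<xi> k)"
proof -
  note r = even_perms3_rotate[OF p]
  note r2 = even_perms3_rotate[OF r]
  note H = hor_part_horizontal
  have X: "X = H X + \<eta> i X *\<^sub>R \<xi> i + \<eta> j X *\<^sub>R \<xi> j + \<eta> k X *\<^sub>R \<xi> k" for X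
    unfolding hor_part_eq[OF p] by simp
  have "br (H X) Y = br (H X) (H Y)"
    using X[of Y] br_xi_horizontal[OF _ H[of X]] br_swap[of "H X" "\<xi> _"] even_perms3_index[OF p]
    by (metis (no_types, lifting) add.right_neutral br_simps(2,8) neg_equal_0_iff_equal scaleR_zero_right)
  moreover have "br X Y = br (H X) Y + \<eta> i X *\<^sub>R br (\<xi> i) Y + \<eta> j X *\<^sub>R br (\<xi> j) Y + \<eta> k X *\<^sub>R br (\<xi> k) Y"
    by (subst X[of X]) (simp add: br_simps)
  ultimately show ?thesis
    by (simp add: br_xi[OF p] br_xi[OF r] br_xi[OF r2] algebra_simps)
qed

lemma eta_br:
  assumes p: "(i, j, k) \<in> even_perms3"
  shows "\<eta> i (br X Y) = 2 * \<delta> * (\<eta> j X * \<eta> k Y - \<eta> k X * \<eta> j Y)"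
proof -
  have i: "i \<in> {1,2,3}" using even_perms3_index[OF p] by blast
  note r = even_perms3_rotate[OF p]
  note r2 = even_perms3_rotate[OF r]
  have "\<eta> i (br (H X) (H Y)) = 0"
    by (rule horizontalD[OF br_horizontal[OF hor_part_horizontal hor_part_horizontal] i])
  then show ?thesis
    using frame[OF p] frame[OF r] frame[OF r2]
    by (subst br_decompose[OF p]) (simp add: eta_simps[OF i])
qed

text \<open>Replaces membership in a span by an equation, to which the linearity of \<open>H\<close>
  applies.\<close>

lemma vertical_iff: "X \<in> vertical \<xi> \<longleftrightarrow> H X = 0"
proof
  assume "X \<in> vertical \<xi>"
  then show "H X = 0"
    unfolding vertical_def
    by (rule linear_eq_0_on_span[OF hor_part_linear, rotated]) (auto simp: hor_part_xi simp del: One_nat_def)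
next
  have p: "(1, 2, 3) \<in> even_perms3" by (simp add: even_perms3_def)
  assume "H X = 0"
  then have "X = \<eta> 1 X *\<^sub>R \<xi> 1 + \<eta> 2 X *\<^sub>R \<xi> 2 + \<eta> 3 X *\<^sub>R \<xi> 3"
    unfolding hor_part_eq[OF p] by (simp add: algebra_simps)
  also have "\<dots> \<in> vertical \<xi>"
    unfolding vertical_def by (intro span_add span_scale span_base) auto
  finally show "X \<in> vertical \<xi>" .
qed

lemma direct_product: "lie_direct_product br (vertical \<xi>) h"
proof -
  have p: "(1, 2, 3) \<in> even_perms3" by (simp add: even_perms3_def)
  have *: "H (H X) = H X" for X by (rule hor_part_id[OF hor_part_horizontal])
  have h_iff: "X \<in> h \<longleftrightarrow> H X = X" for X using hor_part_horizontal[of X] hor_part_id by auto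
  show ?thesis
    unfolding lie_direct_product_def
  proof (intro conjI allI ballI)
    show "subspace (vertical \<xi>)" unfolding vertical_def by (rule subspace_span)
    show "subspace h" unfolding subspace_def h_iff
      by (simp add: linear_0[OF hor_part_linear] linear_add[OF hor_part_linear] linear_scale[OF hor_part_linear]
          hor_part_id)
    show "vertical \<xi> \<inter> h = {0}"
      using linear_0[OF hor_part_linear] by (auto simp: vertical_iff h_iff)
    show "\<exists>x\<in>vertical \<xi>. \<exists>y\<in>h. z = x + y" for z
      by (rule bexI[of _ "z - H z"], rule bexI[of _ "H z"])
        (simp_all add: hor_part_horizontal vertical_iff linear_diff[OF hor_part_linear] *)
    show "br x y \<in> vertical \<xi>" if "x \<in> vertical \<xi>" "y \<in> vertical \<xi>" for x y
    proof -
      have "br x y \<in> span {\<xi> 1, \<xi> 2, \<xi> 3}"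
        using that[unfolded vertical_iff] unfolding br_decompose[OF p, of x y]
        by (simp add: br_simps del: One_nat_def) (intro span_add span_diff span_scale span_base; simp)
      then show ?thesis by (simp add: vertical_def)
    qed
    show "br x y \<in> h" if "x \<in> h" "y \<in> h" for x y using that by (rule br_horizontal)
    show "br x y = 0" if "x \<in> vertical \<xi>" "y \<in> h" for x y
      using that horizontalD[OF that(2)] unfolding br_decompose[OF p, of x y]
      by (simp add: vertical_iff br_simps del: One_nat_def)
  qed
qed

text \<open>The maps \<open>\<phi> i\<close> themselves serve as J: the correction terms that
  separate their relations from the quaternionic ones contain a factor \<open>\<eta> i\<close> or
  \<open>\<eta> j\<close>, zero on \<open>h\<close>.\<close>

lemma hypercomplex: "abelian_hypercomplex br h \<phi>"
proof -
  have p: "(1, 2, 3) \<in> even_perms3" by (simp add: even_perms3_def)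
  have "linear_on_subspace h (\<phi> i)" if "i \<in> {1,2,3}" for i
    unfolding linear_on_subspace_def by (simp add: phi_simps[OF that])
  moreover have "\<phi> 1 (\<phi> 2 x) = \<phi> 3 x \<and> - \<phi> 2 (\<phi> 1 x) = \<phi> 3 x" if "x \<in> h" for x
    using quaternionic(1,2)[OF p, of x] horizontalD[OF that] by (simp del: One_nat_def)
  moreover have "br (\<phi> i x) (\<phi> i y) = br x y" if "i \<in> {1,2,3}" "x \<in> h" "y \<in> h" for i x y
    using contact(6)[OF that(1)] horizontalD that by blast
  ultimately show ?thesis
    unfolding abelian_hypercomplex_def
    by (intro conjI ballI image_subsetI) (simp_all only: phi_horizontal phi_phi_horizontal)
qed

end

section \<open>The Lie algebra so(3) as the space of cross product matrices\<close>

definition cross_matrix :: "real \<Rightarrow> real \<Rightarrow> real \<Rightarrow> real^3^3" where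
  "cross_matrix a b c = vector [vector [0, - c, b], vector [c, 0, - a], vector [- b, a, 0]]"

lemma cross_matrix_nth:
  "cross_matrix a b c $ 1 $ 1 = 0" "cross_matrix a b c $ 1 $ 2 = - c" "cross_matrix a b c $ 1 $ 3 = b"
  "cross_matrix a b c $ 2 $ 1 = c" "cross_matrix a b c $ 2 $ 2 = 0" "cross_matrix a b c $ 2 $ 3 = - a"
  "cross_matrix a b c $ 3 $ 1 = - b" "cross_matrix a b c $ 3 $ 2 = a" "cross_matrix a b c $ 3 $ 3 = 0"
  by (simp_all add: cross_matrix_def)

lemma matrix3_eq_iff: "A = (B :: real^3^3) \<longleftrightarrow> (\<forall>i\<in>{1,2,3}. \<forall>j\<in>{1,2,3}. A $ i $ j = B $ i $ j)"
  by (simp add: vec_eq_iff forall_3)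

lemma cross_matrix_add:
  "cross_matrix a b c + cross_matrix a' b' c' = cross_matrix (a + a') (b + b') (c + c')"
  by (simp add: matrix3_eq_iff cross_matrix_nth)

lemma cross_matrix_scale: "r *\<^sub>R cross_matrix a b c = cross_matrix (r * a) (r * b) (r * c)"
  by (simp add: matrix3_eq_iff cross_matrix_nth)

lemma cross_matrix_inject:
  "cross_matrix a b c = cross_matrix a' b' c' \<longleftrightarrow> a = a' \<and> b = b' \<and> c = c'"
  by (auto simp: matrix3_eq_iff cross_matrix_nth)

text \<open>\<open>cross_matrix a b c\<close> is the matrix of the cross product with the vector (a,
  b, c); commutators of such matrices correspond to cross products of vectors.\<close>

lemma cross_matrix_commutator:
  "matrix_commutator (cross_matrix a b c) (cross_matrix a' b' c') =
    cross_matrix (b * c' - c * b') (c * a' - a * c') (a * b' - b * a')"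
  by (simp add: matrix3_eq_iff cross_matrix_nth matrix_commutator_def matrix_matrix_mult_def sum_3)

lemma so3_iff: "A \<in> so3 \<longleftrightarrow> A = cross_matrix (A $ 3 $ 2) (A $ 1 $ 3) (A $ 2 $ 1)"
  by (auto simp: so3_def matrix3_eq_iff cross_matrix_nth transpose_def)

context parallel_canonical_algebra
begin

lemma vertical_so3: "lie_isomorphic br (vertical \<xi>) matrix_commutator so3"
proof -
  have p: "(1, 2, 3) \<in> even_perms3" by (simp add: even_perms3_def)
  note r = even_perms3_rotate[OF p]
  note r2 = even_perms3_rotate[OF r]
  have i: "1 \<in> {1,2,3::nat}" "2 \<in> {1,2,3::nat}" "3 \<in> {1,2,3::nat}" by auto
  note es = eta_simps[OF i(1)] eta_simps[OF i(2)] eta_simps[OF i(3)]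
  \<comment> \<open>The vertical bracket is 2\<delta> times the cross product, so rescaling the
    coordinates by 2\<delta> turns it into the cross product itself. This map is bijective on the
    vertical space because \<delta> is not 0.\<close>
  define f where "f = (\<lambda>X. cross_matrix (2 * \<delta> * \<eta> 1 X) (2 * \<delta> * \<eta> 2 X) (2 * \<delta> * \<eta> 3 X))"
  show ?thesis
    unfolding lie_isomorphic_def
  proof (intro exI[of _ f] conjI ballI)
    show "linear_on_subspace (vertical \<xi>) f"
      unfolding linear_on_subspace_def f_def
      by (simp add: es cross_matrix_add cross_matrix_scale distrib_left mult.left_commute del: One_nat_def)
    show "bij_betw f (vertical \<xi>) so3"
      unfolding bij_betw_def
    proof
      show "inj_on f (vertical \<xi>)"
      proof (rule inj_onI)
        fix X Y assume XY: "X \<in> vertical \<xi>" "Y \<in> vertical \<xi>" "f X = f Y"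
        then have "\<eta> 1 X = \<eta> 1 Y" "\<eta> 2 X = \<eta> 2 Y" "\<eta> 3 X = \<eta> 3 Y"
          using delta by (simp_all add: f_def cross_matrix_inject del: One_nat_def)
        moreover have "H X = H Y" using XY by (simp add: vertical_iff)
        ultimately show "X = Y" unfolding hor_part_eq[OF p] by simp
      qed
      show "f ` vertical \<xi> = so3"
      proof (intro equalityI subsetI)
        fix M assume "M \<in> f ` vertical \<xi>"
        then show "M \<in> so3" by (auto simp: so3_iff f_def cross_matrix_nth)
      next
        fix M assume M: "M \<in> so3"
        define X where "X = (M $ 3 $ 2 / (2 * \<delta>)) *\<^sub>R \<xi> 1 + (M $ 1 $ 3 / (2 * \<delta>)) *\<^sub>R \<xi> 2 +
          (M $ 2 $ 1 / (2 * \<delta>)) *\<^sub>R \<xi> 3"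
        have "f X = M"
          using frame[OF p] frame[OF r] frame[OF r2] delta M
          by (simp add: f_def X_def es so3_iff[of M, symmetric] del: One_nat_def) (simp add: so3_iff)
        moreover have "X \<in> vertical \<xi>"
          unfolding X_def vertical_def by (intro span_add span_scale span_base) auto
        ultimately show "M \<in> f ` vertical \<xi>" by blast
      qed
    qed
    show "f (br X Y) = matrix_commutator (f X) (f Y)" for X Y
      unfolding f_def eta_br[OF p] eta_br[OF r] eta_br[OF r2] cross_matrix_commutator
      by (simp add: algebra_simps)
  qed
qed

section \<open>The coefficients of the canonical connection\<close>

lemma g_xi:
  assumes i: "i \<in> {1,2,3}"
  shows "g X (\<xi> i) = \<eta> i X"
  using contact(5)[OF i, of X "\<xi> i"] contact(4)[OF i] phi_xi[OF i] by (simp add: g_simps)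

text \<open>Compatibility of g with \<open>\<phi> i\<close>, applied to X and
  \<open>\<phi> i Y\<close>. The correction terms carry a factor
  \<open>\<eta> i (\<phi> i _)\<close> and vanish.\<close>

lemma g_phi:
  assumes i: "i \<in> {1,2,3}"
  shows "g (\<phi> i X) Y = - g X (\<phi> i Y)"
  using contact(5)[OF i, of X "\<phi> i Y"] phi_xi(2)[OF i]
  by (simp add: contact(3)[OF i] g_simps g_xi[OF i])

lemma g_horizontal:
  assumes "X \<in> h"
  shows "g X (H Y) = g X Y"
proof -
  have p: "(1, 2, 3) \<in> even_perms3" by (simp add: even_perms3_def)
  show ?thesis
    unfolding hor_part_eq[OF p] by (simp add: g_simps g_xi horizontalD[OF assms] del: One_nat_def)
qed

text \<open>The abelian condition for X and \<open>\<phi> i Y\<close>, with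
  \<open>\<phi> i (\<phi> i Y) = - Y\<close> on horizontal vectors. The sign is the same as in
  \<open>g_phi\<close>.\<close>

lemma br_phi_horizontal:
  assumes i: "i \<in> {1,2,3}" and X: "X \<in> h" and Y: "Y \<in> h"
  shows "br (\<phi> i X) Y = - br X (\<phi> i Y)"
  using contact(6)[OF i, of X "\<phi> i Y"] phi_xi(2)[OF i] horizontalD[OF X i] phi_phi_horizontal[OF i Y]
  by (simp add: br_simps minus_equation_iff)

text \<open>
  Koszul's formula for a metric connection with torsion \<open>T\<close> reduces to this one, since all terms
  with a vertical argument cancel.
\<close>

definition \<Gamma> :: "'a \<Rightarrow> 'a \<Rightarrow> 'a" where
  "\<Gamma> x y = (SOME w. \<forall>z. g w z = - g (br (H y) (H z)) x)"

lemma g_Gamma: "g (\<Gamma> x y) z = - g (br (H y) (H z)) x"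
proof -
  have "linear (\<lambda>z. - g (br (H y) (H z)) x)"
    by (rule linearI)
      (simp_all add: linear_add[OF hor_part_linear] linear_scale[OF hor_part_linear] br_simps g_simps)
  then obtain w where "\<forall>z. g w z = - g (br (H y) (H z)) x" by (rule riesz) blast
  then have "\<forall>z. g (\<Gamma> x y) z = - g (br (H y) (H z)) x" unfolding \<Gamma>_def by (rule someI)
  then show ?thesis by blast
qed

lemma Gamma_bilinear: "bounded_bilinear \<Gamma>"
proof -
  note Hs = linear_add[OF hor_part_linear] linear_scale[OF hor_part_linear]
  have "bilinear \<Gamma>"
    unfolding bilinear_def
    by (intro conjI allI linearI; rule g_eqI) (simp_all add: g_simps g_Gamma Hs br_simps)
  then show ?thesis by (simp add: bilinear_conv_bounded_bilinear)
qed

lemma Gamma_metric: "g (\<Gamma> x y) z + g y (\<Gamma> x z) = 0"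
  using br_swap[of "H y" "H z"] by (simp add: g_sym[of y] g_Gamma g_simps)

text \<open>Paired with z, the left side moves \<open>\<phi> i\<close> across the bracket and the
  right side moves it across g. Each move costs one sign, and both sides become
  \<open>g (br (H y) (\<phi> i (H z))) x\<close>.\<close>

lemma Gamma_parallel:
  assumes i: "i \<in> {1,2,3}"
  shows "\<Gamma> x (\<phi> i y) = \<phi> i (\<Gamma> x y)"
  by (rule g_eqI) (simp add: g_phi[OF i] g_Gamma hor_part_phi[OF i] g_simps
      br_phi_horizontal[OF i hor_part_horizontal hor_part_horizontal])

text \<open>The two \<Gamma>-terms supply two of the three summands of \<open>c_form\<close>. The
  horizontal part of \<open>br x y\<close> supplies the third, and its vertical part the multiple of
  \<open>wedge3\<close>. By \<open>hh\<close>, projecting the last slot changes nothing.\<close>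

lemma Gamma_torsion: "g (\<Gamma> x y - \<Gamma> y x - br x y) z = T_form br \<xi> \<eta> g x y z"
proof -
  have p: "(1, 2, 3) \<in> even_perms3" by (simp add: even_perms3_def)
  have hh: "g (br (H x) (H y)) (H z) = g (br (H x) (H y)) z" for x y z
    by (rule g_horizontal[OF br_horizontal[OF hor_part_horizontal hor_part_horizontal]])
  have "g (br x y) z = g (br (H x) (H y)) z + 2 * \<delta> * wedge3 (\<eta> 1) (\<eta> 2) (\<eta> 3) x y z"
    unfolding br_decompose[OF p, of x y] wedge3_def
    by (simp add: g_simps g_sym[of "\<xi> _"] g_xi algebra_simps del: One_nat_def)
  then show ?thesis
    unfolding T_form_def c_form_def c_form_h_def hh
    using br_swap[of "H z" "H x"] by (simp add: g_simps g_Gamma)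
qed

lemma T_form_swap:
  "T_form br \<xi> \<eta> g x y z = - T_form br \<xi> \<eta> g y x z"
  "T_form br \<xi> \<eta> g x y z = - T_form br \<xi> \<eta> g x z y"
  unfolding T_form_def c_form_def c_form_h_def wedge3_def
  using br_swap[of "H x" "H y"] br_swap[of "H y" "H z"] br_swap[of "H z" "H x"]
  by (simp_all add: g_simps algebra_simps)

text \<open>
  The difference \<open>A\<close> of two solutions is a 3-form with \<open>A x (\<phi>\<^sub>i y) z = - A x y (\<phi>\<^sub>i z)\<close>, and moving
  \<open>\<phi>\<^sub>i\<close> once around the three slots gives \<open>A (\<phi>\<^sub>i x) y z = - A (\<phi>\<^sub>i x) y z\<close>.
\<close>

lemma Gamma_unique:
  assumes metric: "\<And>x y z. g (G x y) z + g y (G x z) = 0"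
    and skew: "\<And>x y z. g (G x y - G y x - br x y) z = - g (G x z - G z x - br x z) y"
    and parallel: "\<And>i x y. i \<in> {1,2,3} \<Longrightarrow> G x (\<phi> i y) = \<phi> i (G x y)"
  shows "G = \<Gamma>"
proof (intro ext g_eqI)
  fix x y z
  define A where "A = (\<lambda>x y z. g (G x y - \<Gamma> x y) z)"
  have A23: "A x y z = - A x z y" for x y z
    using metric[of x y z] Gamma_metric[of x y z] by (simp add: A_def g_simps g_sym[of y])
  \<comment> \<open>The bracket terms drop out on subtraction, since the torsion of \<Gamma> has the
    same antisymmetry by \<open>T_form_swap\<close>.\<close>
  have T: "A x y z - A y x z = - (A x z y - A z x y)" for x y z
    using skew[of x y z] T_form_swap(2)[of x y z]
    unfolding Gamma_torsion[symmetric] by (simp add: A_def g_simps)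
  have A13: "A x y z = - A z y x" for x y z
    using T[of y x z] A23[of y x z] A23[of z x y] A23[of x y z] A23[of z y x] by linarith
  have A12: "A x y z = - A y x z" for x y z
    using A13 A23 by metis
  have par: "A x (\<phi> i y) z = - A x y (\<phi> i z)" if "i \<in> {1,2,3}" for i x y z
    by (simp add: A_def parallel[OF that] Gamma_parallel[OF that] g_simps g_phi[OF that])
  have rot: "A (\<phi> i x) y z = A (\<phi> i z) y x" if "i \<in> {1,2,3}" for i x y z
    using par[OF that, of y x z] A12[of "\<phi> i x" y z] A12[of x y "\<phi> i z"] A12[of y x "\<phi> i z"]
      A13[of x y "\<phi> i z"] by linarith
  have zero: "A x y (\<phi> i z) = 0" if "i \<in> {1,2,3}" for i x y z
    using rot[OF that, of z y x] rot[OF that, of x z y] rot[OF that, of y x z]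
      A23[of "\<phi> i x"] A23[of "\<phi> i y"] A23[of "\<phi> i z"] A13[of x y "\<phi> i z"]
    by (metis add.inverse_inverse equal_neg_zero)
  have one: "1 \<in> {1,2,3::nat}" "2 \<in> {1,2,3::nat}" by auto
  have "(2, 3, 1) \<in> even_perms3" by (simp add: even_perms3_def)
  then have "\<xi> 1 = \<phi> 2 (\<xi> 3)" using frame by metis
  then have z: "z = \<phi> 1 (\<phi> 1 (- z)) + \<eta> 1 z *\<^sub>R \<phi> 2 (\<xi> 3)"
    using contact(3)[OF one(1), of "- z"] eta_simps(3)[OF one(1), of z] by simp
  have "A x y (u + r *\<^sub>R v) = A x y u + r * A x y v" for u v r
    by (simp add: A_def g_simps algebra_simps)
  from arg_cong[OF z, of "A x y"] this have "A x y z = 0"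
    using zero[OF one(1)] zero[OF one(2)] by simp
  then show "g (G x y) z = g (\<Gamma> x y) z" by (simp add: A_def g_simps)
qed

text \<open>The three conjuncts have the shape that \<open>metric_connection_iff\<close>,
  \<open>skew_torsion_iff\<close> and \<open>parallel_endo_iff\<close> produce at each
  point.\<close>

lemma canonical_coeff_iff:
  "(\<forall>x y z. g (G x y) z + g y (G x z) = 0) \<and>
   (\<forall>x y z. g (G x y - G y x - br x y) z = - g (G y x - G x y - br y x) z \<and>
      g (G x y - G y x - br x y) z = - g (G x z - G z x - br x z) y) \<and>
   (\<forall>i\<in>{1,2,3}. \<forall>x y. G x (\<phi> i y) = \<phi> i (G x y)) \<longleftrightarrow> G = \<Gamma>"
  (is "?l \<longleftrightarrow> _")
proof
  assume ?l
  then show "G = \<Gamma>" by (intro Gamma_unique) blast+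
next
  assume G: "G = \<Gamma>"
  show ?l
    unfolding G Gamma_torsion
    by (intro conjI allI ballI) (rule Gamma_metric T_form_swap Gamma_parallel; assumption?)+
qed

text \<open>A metric connection is determined by its torsion, and \<Gamma> realises
  \<open>T_form\<close>. Parallelism of \<open>\<phi> i\<close> is thus a consequence here.\<close>

lemma torsion_coeff_iff:
  "(\<forall>x y z. g (G x y) z + g y (G x z) = 0) \<and>
   (\<forall>x y z. g (G x y - G y x - br x y) z = T_form br \<xi> \<eta> g x y z) \<longleftrightarrow> G = \<Gamma>"
  (is "?l \<longleftrightarrow> _")
proof
  assume l: ?l
  show "G = \<Gamma>"
  proof (intro ext g_eqI)
    fix x y z
    define A where "A = (\<lambda>x y z. g (G x y - \<Gamma> x y) z)"
    have A23: "A x y z = - A x z y" for x y z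
      using l[THEN conjunct1, rule_format, of x y z] Gamma_metric[of x y z]
      by (simp add: A_def g_simps g_sym[of y])
    have A12: "A x y z = A y x z" for x y z
      using l[THEN conjunct2, rule_format, of x y z] Gamma_torsion[of x y z]
      by (simp add: A_def g_simps)
    \<comment> \<open>\<open>A\<close> is symmetric in the first two slots and skew in the last two.
      Six alternating swaps restore the arguments with three sign changes.\<close>
    have "A x y z = 0"
      using A12[of x y z] A23[of y x z] A12[of y z x] A23[of z y x] A12[of z x y] A23[of x z y] by simp
    then show "g (G x y) z = g (\<Gamma> x y) z" by (simp add: A_def g_simps)
  qed
next
  assume "G = \<Gamma>"
  then show ?l by (simp add: Gamma_metric Gamma_torsion)
qed

end

theorem proposition6p18:
  fixes br :: "'a::euclidean_space \<Rightarrow> 'a \<Rightarrow> 'a"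
    and \<phi> :: "nat \<Rightarrow> 'a \<Rightarrow> 'a" and \<xi> :: "nat \<Rightarrow> 'a" and \<eta> :: "nat \<Rightarrow> 'a \<Rightarrow> real"
    and g :: "'a \<Rightarrow> 'a \<Rightarrow> real"
  assumes "almost_3_contact_metric_lie_algebra br \<phi> \<xi> \<eta> g"
    and "parallel_canonical br \<phi> \<xi> \<eta>"
    and "delta_const br \<xi> \<eta> \<noteq> 0"
  shows "lie_direct_product br (vertical \<xi>) (horizontal \<eta>) \<and>
    lie_isomorphic br (vertical \<xi>) matrix_commutator so3 \<and>
    (\<exists>J. abelian_hypercomplex br (horizontal \<eta>) J) \<and>
    (\<forall>(G :: 'p::{t2_space, second_countable_topology} monoid) (A :: ('p, 'a) atlas) L.
       lie_group G A \<and> lie_algebra_of_group G A br L \<longrightarrow>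
         (\<exists>!D. canonical_connection A L \<phi> g D) \<and>
         (\<forall>D. canonical_connection A L \<phi> g D \<longleftrightarrow>
              metric_connection A L g D \<and> has_torsion_form A L g (T_form br \<xi> \<eta> g) D))"
proof -
  interpret parallel_canonical_algebra br \<phi> \<xi> \<eta> g using assms by unfold_locales
  have "(\<exists>!D. canonical_connection A L \<phi> g D) \<and>
      (\<forall>D. canonical_connection A L \<phi> g D \<longleftrightarrow>
           metric_connection A L g D \<and> has_torsion_form A L g (T_form br \<xi> \<eta> g) D)"
    if G: "lie_group G A" "lie_algebra_of_group G A br L"
    for G :: "'p monoid" and A :: "('p, 'a) atlas" and L
  proof -
    interpret F: lie_frame A L br by (rule lie_group_frame[OF G br_bilinear])
    have affine: "metric_connection A L g D \<Longrightarrow> affine_connection A D" for D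
      unfolding metric_connection_def by blast
    \<comment> \<open>Coefficients constantly equal to \<Gamma> single out one connection. Both
      descriptions in the theorem are reduced to \<open>D = F.frame_connection \<Gamma>\<close>,
      which yields the equivalence as well as existence and uniqueness.\<close>
    have eq: "D = F.frame_connection \<Gamma> \<longleftrightarrow> affine_connection A D \<and> (\<forall>p. F.coeff D p = \<Gamma>)" for D
      using F.affine_frame_connection[OF Gamma_bilinear] F.coeff_frame_connection F.connection_eqI
      by blast
    have 1: "canonical_connection A L \<phi> g D \<longleftrightarrow> D = F.frame_connection \<Gamma>" for D
    \<comment> \<open>The pointwise reformulations assume an affine connection. If \<open>D\<close>
      is not affine, both sides are false.\<close>
    proof (cases "affine_connection A D")
      case True
      have par: "(\<forall>i\<in>{1,2,3}. parallel_endo A L (\<phi> i) D) \<longleftrightarrow>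
          (\<forall>i\<in>{1,2,3}. \<forall>p x y. F.coeff D p x (\<phi> i y) = \<phi> i (F.coeff D p x y))"
        by (rule ball_cong[OF refl F.parallel_endo_iff[OF True contact(1)]])
      show ?thesis
        unfolding eq canonical_connection_def F.metric_connection_iff[OF True g_bilinear]
          F.skew_torsion_iff[OF True] par canonical_coeff_iff[symmetric]
        using True by blast
    qed (use affine eq canonical_connection_def in blast)
    have 2: "metric_connection A L g D \<and> has_torsion_form A L g (T_form br \<xi> \<eta> g) D \<longleftrightarrow>
        D = F.frame_connection \<Gamma>" for D
    proof (cases "affine_connection A D")
      case True
      show ?thesis
        unfolding eq F.metric_connection_iff[OF True g_bilinear] F.has_torsion_form_iff[OF True]
          torsion_coeff_iff[symmetric]
        using True by blast
    qed (use affine eq in blast)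
    show ?thesis unfolding 1 2 by simp
  qed
  then show ?thesis using direct_product vertical_so3 hypercomplex by blast
qed

end
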